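(* Let $\mathcal{H}$ be a complex Hilbert space and let $A\in\mathcal{B}(\mathcal{H})$ have the Cartesian decomposition $A=B+iC$ with $B,C$ self adjoint. Then for any $1\le r\le 2$, \[\frac{1}{4^{r}}\left\| A^{*}A+AA^{*} \right\|^{r}\le \left\| \int_{0}^{1}\left( (1-t)B^{2}+tC^{2} \right)^{r}dt \right\|\le w^{2r}(A).\] In particular, \[\frac{1}{4}\left\| A^{*}A+AA^{*} \right\|\le \left\| \int_{0}^{1}\left( (1-t)B^{2}+tC^{2} \right)^{2}dt \right\|^{\frac{1}{2}}\le w^{2}(A).\]
   Context: $\mathcal{B}(\mathcal{H})$ is the $C^*$-algebra of bounded linear operators on the complex Hilbert space $\mathcal{H}$; $\|\cdot\|$ is the operator norm; $w(A)=\sup_{\|x\|=1}|\langle Ax,x\rangle|$ is the numerical radius, and $w^{s}(A)=(w(A))^{s}$. The Cartesian decomposition of $A$ is the expression $A=B+iC$ with $B,C$ self adjoint. Powers of positive semi-definite operators are defined by functional calculus. *)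

theory Defs
  imports "HOL-Analysis.Analysis" "HOL-Computational_Algebra.Polynomial"
begin

section \<open>Complex Hilbert spaces\<close>

class complex_vector = real_vector +
  fixes scaleC :: "complex \<Rightarrow> 'a \<Rightarrow> 'a"  (infixr "*\<^sub>C" 75)
  assumes scaleC_of_real: "complex_of_real r *\<^sub>C x = r *\<^sub>R x"
    and scaleC_add_right: "c *\<^sub>C (x + y) = c *\<^sub>C x + c *\<^sub>C y"
    and scaleC_add_left: "(c + d) *\<^sub>C x = c *\<^sub>C x + d *\<^sub>C x"
    and scaleC_scaleC: "c *\<^sub>C d *\<^sub>C x = (c * d) *\<^sub>C x"

text \<open>The inner product is linear in its first argument and conjugate-linear in the second.
  Positivity and definiteness follow from \<open>cinner_same\<close>.\<close>

class complex_inner = complex_vector + real_normed_vector +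
  fixes cinner :: "'a \<Rightarrow> 'a \<Rightarrow> complex"
  assumes cinner_commute: "cinner x y = cnj (cinner y x)"
    and cinner_add_left: "cinner (x + y) z = cinner x z + cinner y z"
    and cinner_scaleC_left: "cinner (c *\<^sub>C x) y = c * cinner x y"
    and cinner_same: "cinner x x = complex_of_real ((norm x)\<^sup>2)"

class complex_hilbert = complex_inner + complete_space

subclass (in complex_hilbert) banach ..

instantiation complex :: complex_hilbert
begin
definition scaleC_complex :: "complex \<Rightarrow> complex \<Rightarrow> complex"
  where "scaleC_complex = (*)"
definition cinner_complex :: "complex \<Rightarrow> complex \<Rightarrow> complex"
  where "cinner_complex x y = x * cnj y"
instance
  by standard
    (simp_all add: scaleC_complex_def cinner_complex_def scaleR_conv_of_real algebra_simps
      complex_norm_square [symmetric])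
end


section \<open>The algebra of bounded operators\<close>

typedef (overloaded) 'a bop =
  "{T :: 'a::complex_hilbert \<Rightarrow>\<^sub>L 'a. \<forall>c x. blinfun_apply T (c *\<^sub>C x) = c *\<^sub>C blinfun_apply T x}"
  morphisms blinfun_of_bop Bop
proof
  show "0 \<in> {T :: 'a \<Rightarrow>\<^sub>L 'a. \<forall>c x. blinfun_apply T (c *\<^sub>C x) = c *\<^sub>C blinfun_apply T x}"
    using scaleC_add_right [where ?'a = 'a and x = 0 and y = 0] by simp
qed

setup_lifting type_definition_bop

lift_definition bop_apply :: "'a::complex_hilbert bop \<Rightarrow> 'a \<Rightarrow> 'a" is blinfun_apply .

lemma scaleC_zero_right [simp]: "c *\<^sub>C (0::'a::complex_vector) = 0"
  using scaleC_add_right [of c "0::'a" 0] by simp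

lemma scaleC_minus_right: "c *\<^sub>C (- x) = - (c *\<^sub>C (x::'a::complex_vector))"
  using scaleC_add_right [of c x "- x"] by (simp add: eq_neg_iff_add_eq_0 add.commute)

lemma scaleC_diff_right: "c *\<^sub>C (x - y) = c *\<^sub>C x - c *\<^sub>C (y::'a::complex_vector)"
  using scaleC_add_right [of c x "- y"] by (simp add: scaleC_minus_right)

lemma scaleR_scaleC_commute: "r *\<^sub>R c *\<^sub>C x = c *\<^sub>C r *\<^sub>R (x::'a::complex_vector)"
  unfolding scaleC_of_real [symmetric] scaleC_scaleC by (simp add: mult.commute)

lemma cinner_add_right: "cinner x (y + z) = cinner x y + cinner x (z::'a::complex_inner)"
  by (metis cinner_add_left cinner_commute complex_cnj_add)

lemma cinner_scaleC_right: "cinner x (c *\<^sub>C y) = cnj c * cinner x (y::'a::complex_inner)"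
  by (metis cinner_commute cinner_scaleC_left complex_cnj_mult)

lemma norm_scaleC: "norm (c *\<^sub>C x) = cmod c * norm (x::'a::complex_inner)"
proof -
  have "complex_of_real ((norm (c *\<^sub>C x))\<^sup>2) = complex_of_real ((cmod c * norm x)\<^sup>2)"
    unfolding cinner_same [symmetric] cinner_scaleC_left cinner_scaleC_right
    by (simp add: cinner_same power_mult_distrib complex_norm_square del: of_real_power mult_ac)
  then have "(norm (c *\<^sub>C x))\<^sup>2 = (cmod c * norm x)\<^sup>2"
    using of_real_eq_iff by blast
  then show ?thesis
    by (simp add: power2_eq_iff_nonneg)
qed

lemma bounded_linear_scaleC: "bounded_linear (\<lambda>x::'a::complex_inner. c *\<^sub>C x)"
  by (rule bounded_linear_intro [where K = "cmod c"])
    (simp_all add: scaleC_add_right scaleR_scaleC_commute norm_scaleC)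

lemma bounded_linear_scaleC_blinfun:
  "bounded_linear (\<lambda>x. c *\<^sub>C (blinfun_apply T x :: 'a::complex_inner))"
  by (rule bounded_linear_compose [OF bounded_linear_scaleC blinfun.bounded_linear_right])

text \<open>The norm is the operator norm inherited from \<open>blinfun\<close>, and multiplication is composition.
  There is no instance of \<open>ring_1\<close>, because identity and zero coincide on the zero space.\<close>

instantiation bop :: (complex_hilbert) "{complex_vector, real_normed_vector, ring, monoid_mult}"
begin
lift_definition zero_bop :: "'a bop" is 0 by simp
lift_definition plus_bop :: "'a bop \<Rightarrow> 'a bop \<Rightarrow> 'a bop" is "(+)"
  by (simp add: blinfun.add_left scaleC_add_right)
lift_definition minus_bop :: "'a bop \<Rightarrow> 'a bop \<Rightarrow> 'a bop" is "(-)"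
  by (simp add: blinfun.diff_left scaleC_diff_right)
lift_definition uminus_bop :: "'a bop \<Rightarrow> 'a bop" is uminus
  by (simp add: blinfun.minus_left scaleC_minus_right)
lift_definition scaleR_bop :: "real \<Rightarrow> 'a bop \<Rightarrow> 'a bop" is "scaleR"
  by (simp add: blinfun.scaleR_left scaleR_scaleC_commute)
lift_definition scaleC_bop :: "complex \<Rightarrow> 'a bop \<Rightarrow> 'a bop"
  is "\<lambda>c T. Blinfun (\<lambda>x. c *\<^sub>C blinfun_apply T x)"
  by (simp add: bounded_linear_Blinfun_apply [OF bounded_linear_scaleC_blinfun] scaleC_scaleC
      mult.commute)
lift_definition norm_bop :: "'a bop \<Rightarrow> real" is norm .
lift_definition one_bop :: "'a bop" is id_blinfun by simp
lift_definition times_bop :: "'a bop \<Rightarrow> 'a bop \<Rightarrow> 'a bop" is "(o\<^sub>L)" by simp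
definition dist_bop :: "'a bop \<Rightarrow> 'a bop \<Rightarrow> real"
  where "dist_bop S T = norm (S - T)"
definition sgn_bop :: "'a bop \<Rightarrow> 'a bop"
  where "sgn_bop T = inverse (norm T) *\<^sub>R T"
definition uniformity_bop :: "('a bop \<times> 'a bop) filter"
  where "uniformity_bop = (INF e\<in>{0<..}. principal {(S, T). dist S T < e})"
definition open_bop :: "'a bop set \<Rightarrow> bool"
  where "open_bop U = (\<forall>T\<in>U. eventually (\<lambda>(T', S). T' = T \<longrightarrow> S \<in> U) uniformity)"

lemma bop_eqI: "(\<And>x. bop_apply S x = bop_apply T x) \<Longrightarrow> S = T"
  by transfer (rule blinfun_eqI)

lemma bop_apply_simps [simp]:
  "bop_apply 0 x = 0"
  "bop_apply 1 x = x"
  "bop_apply (S + T) x = bop_apply S x + bop_apply T x"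
  "bop_apply (S - T) x = bop_apply S x - bop_apply T x"
  "bop_apply (- T) x = - bop_apply T x"
  "bop_apply (r *\<^sub>R T) x = r *\<^sub>R bop_apply T x"
  "bop_apply (S * T) x = bop_apply S (bop_apply T x)"
  by (transfer; simp add: blinfun.add_left blinfun.diff_left blinfun.minus_left
      blinfun.scaleR_left)+

lemma bop_apply_scaleC_left [simp]: "bop_apply (c *\<^sub>C T) x = c *\<^sub>C bop_apply T x"
  by transfer (simp add: bounded_linear_Blinfun_apply [OF bounded_linear_scaleC_blinfun])

lemma bop_apply_linear:
  "bop_apply T (x + y) = bop_apply T x + bop_apply T y"
  "bop_apply T (c *\<^sub>C x) = c *\<^sub>C bop_apply T x"
  by (transfer; simp add: blinfun.add_right)+

instance
proof
  fix S T U :: "'a bop" and r s :: real and c d :: complex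
  show "S + T + U = S + (T + U)" "S + T = T + S" "0 + S = S" "- S + S = 0" "S - T = S + - T"
    "r *\<^sub>R (S + T) = r *\<^sub>R S + r *\<^sub>R T" "(r + s) *\<^sub>R S = r *\<^sub>R S + s *\<^sub>R S"
    "r *\<^sub>R s *\<^sub>R S = (r * s) *\<^sub>R S" "1 *\<^sub>R S = S"
    by (rule bop_eqI; simp add: algebra_simps)+
  show "complex_of_real r *\<^sub>C S = r *\<^sub>R S" "c *\<^sub>C (S + T) = c *\<^sub>C S + c *\<^sub>C T"
    "(c + d) *\<^sub>C S = c *\<^sub>C S + d *\<^sub>C S" "c *\<^sub>C d *\<^sub>C S = (c * d) *\<^sub>C S"
    by (rule bop_eqI; simp add: scaleC_of_real scaleC_add_right scaleC_add_left scaleC_scaleC)+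
  show "S * T * U = S * (T * U)" "(S + T) * U = S * U + T * U" "S * (T + U) = S * T + S * U"
    "1 * S = S" "S * 1 = S"
    by (rule bop_eqI; simp add: bop_apply_linear)+
  show "(norm S = 0) = (S = 0)" "norm (r *\<^sub>R S) = \<bar>r\<bar> * norm S"
    by (transfer; simp)+
  show "norm (S + T) \<le> norm S + norm T"
    by transfer (rule norm_triangle_ineq)
qed (fact dist_bop_def sgn_bop_def uniformity_bop_def open_bop_def)+
end

instance bop :: (complex_hilbert) banach
proof
  fix X :: "nat \<Rightarrow> 'a bop"
  assume "Cauchy X"
  then have "Cauchy (\<lambda>n. blinfun_of_bop (X n))"
    by (simp add: Cauchy_def dist_norm norm_bop.rep_eq minus_bop.rep_eq)
  then obtain T where T: "(\<lambda>n. blinfun_of_bop (X n)) \<longlonglongrightarrow> T"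
    using Cauchy_convergent convergent_def by blast
  have lim: "(\<lambda>n. blinfun_apply (blinfun_of_bop (X n)) x) \<longlonglongrightarrow> blinfun_apply T x" for x
    using T by (intro tendsto_intros)
  have "blinfun_apply T (c *\<^sub>C x) = c *\<^sub>C blinfun_apply T x" for c x
  proof -
    have "(\<lambda>n. c *\<^sub>C blinfun_apply (blinfun_of_bop (X n)) x) \<longlonglongrightarrow> c *\<^sub>C blinfun_apply T x"
      by (rule bounded_linear.tendsto [OF bounded_linear_scaleC lim])
    moreover have "(\<lambda>n. c *\<^sub>C blinfun_apply (blinfun_of_bop (X n)) x)
        = (\<lambda>n. blinfun_apply (blinfun_of_bop (X n)) (c *\<^sub>C x))"
      by (simp add: bop_apply_linear(2) [unfolded bop_apply.rep_eq])
    ultimately show ?thesis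
      using lim LIMSEQ_unique by metis
  qed
  then have "blinfun_of_bop (Bop T) = T"
    by (simp add: Bop_inverse)
  then have "X \<longlonglongrightarrow> Bop T"
    using T by (simp add: LIMSEQ_def dist_norm norm_bop.rep_eq minus_bop.rep_eq)
  then show "convergent X"
    by (auto simp: convergent_def)
qed


section \<open>Adjoint and numerical radius\<close>

definition cadjoint :: "'a::complex_hilbert bop \<Rightarrow> 'a bop"
  where "cadjoint T = (THE S. \<forall>x y. cinner (bop_apply T x) y = cinner x (bop_apply S y))"

text \<open>The definite description in \<open>cadjoint\<close> is legitimate by the Riesz representation theorem.\<close>

lemma norm_add_square:
  "(norm (x + y :: 'a::complex_inner))\<^sup>2 = (norm x)\<^sup>2 + (norm y)\<^sup>2 + 2 * Re (cinner x y)"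
proof -
  have "complex_of_real ((norm (x + y))\<^sup>2) = cinner x x + cinner y y + (cinner x y + cinner y x)"
    unfolding cinner_same [symmetric] by (simp add: cinner_add_left cinner_add_right)
  from arg_cong [OF this, of Re] show ?thesis
    using cinner_commute [of y x] by (simp add: cinner_same del: of_real_power)
qed

lemma Re_cinner_le: "Re (cinner x y) \<le> norm x * norm (y::'a::complex_inner)"
proof -
  have "(norm (x + y))\<^sup>2 \<le> (norm x + norm y)\<^sup>2"
    by (simp add: norm_triangle_ineq power_mono)
  then show ?thesis
    by (simp add: norm_add_square power2_sum)
qed

lemma cinner_scaleR_right: "cinner x (r *\<^sub>R y) = of_real r * cinner x (y::'a::complex_inner)"
  by (simp add: scaleC_of_real [symmetric] cinner_scaleC_right)

lemma cinner_diff_right: "cinner x (y - z) = cinner x y - cinner x (z::'a::complex_inner)"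
  using cinner_add_right [of x "y - z" z] by simp

lemma norm_parallelogram:
  "(norm (x - y))\<^sup>2 + (norm (x + y))\<^sup>2 = 2 * (norm x)\<^sup>2 + 2 * (norm (y::'a::complex_inner))\<^sup>2"
proof -
  have "Re (cinner x (- y)) = - Re (cinner x y)"
    using cinner_diff_right [of x y y] cinner_diff_right [of x "y - y" y] by simp
  then show ?thesis
    using norm_add_square [of x y] norm_add_square [of x "- y"] by simp
qed

lemma bounded_linear_bop_apply: "bounded_linear (bop_apply T)"
  by transfer (rule blinfun.bounded_linear_right)

lemma bop_norm_apply: "norm (bop_apply T x) \<le> norm T * norm x"
  by transfer (rule norm_blinfun)

lemma Riesz_representation:
  fixes T :: "'a::complex_hilbert bop"
  shows "\<exists>z. \<forall>x. cinner (bop_apply T x) y = cinner x z"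
proof -
  define f where "f = (\<lambda>x. Re (cinner (bop_apply T x) y))"
  define J where "J = (\<lambda>x. (norm x)\<^sup>2 - 2 * f x)"
  define K where "K = norm T * norm y"
  have f_le: "f x \<le> K * norm x" for x
  proof -
    have "f x \<le> norm (bop_apply T x) * norm y"
      unfolding f_def by (rule Re_cinner_le)
    also have "\<dots> \<le> (norm T * norm x) * norm y"
      by (intro mult_right_mono bop_norm_apply) simp
    finally show ?thesis
      by (simp add: K_def ac_simps)
  qed
  have f_add: "f (x + x') = f x + f x'" for x x'
    by (simp add: f_def bop_apply_linear cinner_add_left)
  have f_scaleR: "f (r *\<^sub>R x) = r * f x" for r x
    by (simp add: f_def scaleC_of_real [symmetric] bop_apply_linear cinner_scaleC_left)
  have "\<bar>f x\<bar> \<le> K * norm x" for x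
    using f_le [of x] f_le [of "-1 *\<^sub>R x"] unfolding f_scaleR by simp
  then have "bounded_linear f"
    by (intro bounded_linear_intro [where K = K]) (simp_all add: f_add f_scaleR mult.commute)
  have J_ge: "- K\<^sup>2 \<le> J x" for x
    using f_le [of x] zero_le_power2 [of "norm x - K"]
    unfolding J_def power2_diff by (simp add: mult.commute [of K])
  define m where "m = Inf (range J)"
  have m_le: "m \<le> J x" for x
    unfolding m_def using J_ge by (intro cInf_lower bdd_belowI [where m = "- K\<^sup>2"]) auto
  have "\<exists>x. J x < m + 1 / real (Suc n)" for n
    using cInf_lessD [of "range J" "m + 1 / real (Suc n)"] unfolding m_def by auto
  then obtain v where v: "J (v n) < m + 1 / real (Suc n)" for n
    by metis
  have mid: "(norm (a - b))\<^sup>2 \<le> 2 * (J a - m) + 2 * (J b - m)" for a b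
  proof -
    have "(norm ((1/2) *\<^sub>R (a + b)))\<^sup>2 = (norm (a + b))\<^sup>2 / 4"
      by (simp only: norm_scaleR power_mult_distrib) (simp add: power_divide)
    then have "m \<le> (norm (a + b))\<^sup>2 / 4 - (f a + f b)"
      using m_le [of "(1/2) *\<^sub>R (a + b)"] unfolding J_def f_scaleR f_add
      by (simp add: power_divide add_divide_distrib)
    then show ?thesis
      using norm_parallelogram [of a b] by (simp add: J_def)
  qed
  have "Cauchy v"
  proof (rule metric_CauchyI)
    fix e :: real
    assume "0 < e"
    then obtain N where N: "inverse (real (Suc N)) < e\<^sup>2 / 4"
      using reals_Archimedean [of "e\<^sup>2 / 4"] by auto
    have "dist (v i) (v j) < e" if "N \<le> i" "N \<le> j" for i j
    proof -
      have small: "J (v k) - m < e\<^sup>2 / 4" if "N \<le> k" for k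
      proof -
        have "1 / real (Suc k) \<le> inverse (real (Suc N))"
          using that by (simp add: inverse_eq_divide frac_le)
        then show ?thesis
          using v [of k] N by linarith
      qed
      have "(norm (v i - v j))\<^sup>2 < e\<^sup>2"
        using mid [of "v i" "v j"] small [OF that(1)] small [OF that(2)] by argo
      then show ?thesis
        using \<open>0 < e\<close> by (simp add: dist_norm power_less_imp_less_base)
    qed
    then show "\<exists>N. \<forall>i\<ge>N. \<forall>j\<ge>N. dist (v i) (v j) < e"
      by blast
  qed
  then obtain z where z: "v \<longlonglongrightarrow> z"
    using Cauchy_convergent convergent_def by blast
  have "(\<lambda>n. J (v n)) \<longlonglongrightarrow> J z"
    unfolding J_def by (intro tendsto_intros z bounded_linear.tendsto [OF \<open>bounded_linear f\<close>])
  moreover have "(\<lambda>n. m + 1 / real (Suc n)) \<longlonglongrightarrow> m + 0"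
    by (intro tendsto_intros LIMSEQ_Suc [OF lim_1_over_n])
  ultimately have "J z \<le> m"
    using v by (intro LIMSEQ_le [where X = "\<lambda>n. J (v n)"]) (auto intro: less_imp_le)
  have Re_eq: "f h = Re (cinner h z)" for h
  proof -
    define d where "d = Re (cinner h z) - f h"
    have ineq: "0 \<le> t\<^sup>2 * (norm h)\<^sup>2 + 2 * t * d" for t
    proof -
      have "J z \<le> J (t *\<^sub>R h + z)"
        using \<open>J z \<le> m\<close> m_le order_trans by blast
      moreover have "Re (cinner (t *\<^sub>R h) z) = t * Re (cinner h z)"
        by (simp add: scaleC_of_real [symmetric] cinner_scaleC_left)
      ultimately show ?thesis
        unfolding J_def norm_add_square f_add f_scaleR d_def
        by (simp add: power_mult_distrib algebra_simps)
    qed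
    define q where "q = (norm h)\<^sup>2 + 1"
    have "q > 0"
      by (simp add: q_def add_nonneg_pos)
    have "0 \<le> (- d / q)\<^sup>2 * q + 2 * (- d / q) * d"
    proof -
      have "(- d / q)\<^sup>2 * (norm h)\<^sup>2 \<le> (- d / q)\<^sup>2 * q"
        by (intro mult_left_mono) (simp_all add: q_def)
      then show ?thesis
        using ineq [of "- d / q"] by (meson add_right_mono order_trans)
    qed
    also have "\<dots> = - (d\<^sup>2 / q)"
      using \<open>q > 0\<close> by (simp add: power2_eq_square field_simps)
    finally have "d\<^sup>2 \<le> 0"
      using \<open>q > 0\<close> by (simp add: field_simps)
    then show ?thesis
      by (simp add: d_def)
  qed
  have "cinner (bop_apply T x) y = cinner x z" for x
  proof (rule complex_eqI)
    show "Re (cinner (bop_apply T x) y) = Re (cinner x z)"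
      using Re_eq [of x] by (simp add: f_def)
    show "Im (cinner (bop_apply T x) y) = Im (cinner x z)"
      using Re_eq [of "\<i> *\<^sub>C x"] by (simp add: f_def bop_apply_linear cinner_scaleC_left)
  qed
  then show ?thesis
    by blast
qed

lemma cinner_right_eqI:
  fixes y z :: "'a::complex_inner"
  assumes "\<And>x. cinner x y = cinner x z"
  shows "y = z"
  using cinner_same [of "y - z"] assms [of "y - z"] by (simp add: cinner_diff_right)

lemma cadjoint_exists_unique:
  fixes T :: "'a::complex_hilbert bop"
  shows "\<exists>!S. \<forall>x y. cinner (bop_apply T x) y = cinner x (bop_apply S y)"
proof (rule ex_ex1I)
  obtain g where g: "cinner (bop_apply T x) y = cinner x (g y)" for x y
    using Riesz_representation [of T] by metis
  have g_add: "g (y + y') = g y + g y'" for y y'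
    by (rule cinner_right_eqI) (simp add: g [symmetric] cinner_add_right)
  have g_scaleC: "g (c *\<^sub>C y) = c *\<^sub>C g y" for c y
    by (rule cinner_right_eqI) (simp add: g [symmetric] cinner_scaleC_right)
  have "norm (g y) \<le> norm y * norm T" for y
  proof (cases "g y = 0")
    case False
    have "norm (g y) * norm (g y) = Re (cinner (bop_apply T (g y)) y)"
      unfolding g by (simp add: cinner_same power2_eq_square)
    also have "\<dots> \<le> norm (bop_apply T (g y)) * norm y"
      by (rule Re_cinner_le)
    also have "\<dots> \<le> (norm T * norm (g y)) * norm y"
      by (intro mult_right_mono bop_norm_apply) simp
    finally have "norm (g y) * norm (g y) \<le> (norm y * norm T) * norm (g y)"
      by (simp add: ac_simps)
    then show ?thesis
      using False by simp
  qed (simp add: norm_bop.rep_eq)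
  then have "bounded_linear g"
    by (intro bounded_linear_intro [where K = "norm T"])
      (simp_all add: g_add g_scaleC scaleC_of_real [symmetric])
  then have "bop_apply (Bop (Blinfun g)) y = g y" for y
    by (simp add: bop_apply.rep_eq Bop_inverse bounded_linear_Blinfun_apply g_scaleC)
  then show "\<exists>S. \<forall>x y. cinner (bop_apply T x) y = cinner x (bop_apply S y)"
    using g by metis
next
  fix S S'
  assume S: "\<forall>x y. cinner (bop_apply T x) y = cinner x (bop_apply S y)"
    and S': "\<forall>x y. cinner (bop_apply T x) y = cinner x (bop_apply S' y)"
  show "S = S'"
  proof (rule bop_eqI, rule cinner_right_eqI)
    show "cinner x (bop_apply S y) = cinner x (bop_apply S' y)" for x y
      using S [rule_format, of x y] S' [rule_format, of x y] by (rule trans [OF sym])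
  qed
qed

lemma cinner_cadjoint: "cinner (bop_apply T x) y = cinner x (bop_apply (cadjoint T) y)"
  using theI' [OF cadjoint_exists_unique [of T]] unfolding cadjoint_def by blast

definition selfadjoint :: "'a::complex_hilbert bop \<Rightarrow> bool"
  where "selfadjoint T \<longleftrightarrow> cadjoint T = T"

text \<open>On the zero space the supremum is taken over the empty set of reals and its value is
  unspecified.\<close>

definition numerical_radius :: "'a::complex_hilbert bop \<Rightarrow> real"
  where "numerical_radius T = (SUP x\<in>{x. norm x = 1}. cmod (cinner (bop_apply T x) x))"


section \<open>Continuous functional calculus\<close>

definition spectrum :: "'a::complex_hilbert bop \<Rightarrow> complex set"
  where "spectrum T = {z. \<not> (\<exists>S. S * (T - z *\<^sub>C 1) = 1 \<and> (T - z *\<^sub>C 1) * S = 1)}"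

definition bop_poly :: "real poly \<Rightarrow> 'a::complex_hilbert bop \<Rightarrow> 'a bop"
  where "bop_poly p T = (\<Sum>i\<le>degree p. coeff p i *\<^sub>R T ^ i)"

text \<open>For self-adjoint \<open>T\<close> (whose spectrum is a compact set of reals) and \<open>f\<close> continuous on the
  spectrum, \<open>f(T)\<close> is the norm limit of \<open>p\<^sub>n(T)\<close> for any polynomials \<open>p\<^sub>n\<close> converging to \<open>f\<close> uniformly
  on the spectrum.  The value has no meaning for other \<open>T\<close> and \<open>f\<close>.\<close>

definition functional_calculus :: "(real \<Rightarrow> real) \<Rightarrow> 'a::complex_hilbert bop \<Rightarrow> 'a bop"
  where "functional_calculus f T =
    (THE S. \<forall>p :: nat \<Rightarrow> real poly.
       uniform_limit {t. complex_of_real t \<in> spectrum T} (\<lambda>n. poly (p n)) f sequentially \<longrightarrow>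
       (\<lambda>n. bop_poly (p n) T) \<longlonglongrightarrow> S)"

text \<open>Meant for positive semi-definite \<open>T\<close> and \<open>r > 0\<close>; recall that \<open>0 powr r = 0\<close>.\<close>

definition bop_powr :: "'a::complex_hilbert bop \<Rightarrow> real \<Rightarrow> 'a bop"
  where "bop_powr T r = functional_calculus (\<lambda>t. t powr r) T"

end

theory Submission
  imports Defs "HOL-Computational_Algebra.Fundamental_Theorem_Algebra"
begin

text \<open>
  Write \<open>X(t) = (1 - t) B\<^sup>2 + t C\<^sup>2\<close>, \<open>M = (B\<^sup>2 + C\<^sup>2) / 2\<close> and \<open>w = w(A)\<close>.  Since
  \<open>A\<^sup>* A + A A\<^sup>* = 2 (B\<^sup>2 + C\<^sup>2) = 4 M\<close>, the claim is
  \<open>\<parallel>M\<parallel>\<^sup>r \<le> \<parallel>\<integral> X(t)\<^sup>r dt\<parallel> \<le> w\<^sup>2\<^sup>r\<close>, and the second pair of inequalities is the square root of the case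
  \<open>r = 2\<close>, in which the functional calculus gives the ordinary square.

  For the upper bound, \<open>\<langle>B x, x\<rangle>\<close> and \<open>\<langle>C x, x\<rangle>\<close> are the real and imaginary parts of \<open>\<langle>A x, x\<rangle>\<close>, so
  \<open>\<parallel>B\<parallel>\<close> and \<open>\<parallel>C\<parallel>\<close> are at most \<open>w\<close>
  (\<open>norm_cartesian_le_numerical_radius\<close>).  Then \<open>\<parallel>X(t)\<parallel> \<le> w\<^sup>2\<close>, hence \<open>\<parallel>X(t)\<^sup>r\<parallel> \<le> w\<^sup>2\<^sup>r\<close>, for all
  \<open>t\<close> (\<open>norm_integral_bop_powr_le\<close>).

  For the lower bound (\<open>norm_average_powr_le\<close>), the scalar inequality
  \<open>s\<^sup>r + r s\<^sup>r\<^sup>-\<^sup>1 (u - s) \<le> u\<^sup>r\<close> between the convex power function and its tangent at \<open>s\<close> gives the operator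
  inequality \<open>s\<^sup>r + r s\<^sup>r\<^sup>-\<^sup>1 (X(t) - s) \<le> X(t)\<^sup>r\<close>.  As \<open>\<integral> X(t) dt = M\<close>, integration yields
  \<open>s\<^sup>r + r s\<^sup>r\<^sup>-\<^sup>1 (M - s) \<le> \<integral> X(t)\<^sup>r dt\<close>.  At a unit vector \<open>x\<close> and for \<open>s = \<langle>M x, x\<rangle>\<close> the linear part
  vanishes, so that \<open>\<langle>M x, x\<rangle>\<^sup>r \<le> \<parallel>\<integral> X(t)\<^sup>r dt\<parallel>\<close>, and the supremum of \<open>\<langle>M x, x\<rangle>\<close> is \<open>\<parallel>M\<parallel>\<close>.

  Both parts rest on the functional calculus of a self-adjoint operator \<open>T\<close>: it preserves order and
  norm bounds, and \<open>X(t)\<^sup>r\<close> is continuous in \<open>t\<close>, so that the integral exists.  All this follows from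
  one fact about polynomials (\<open>qform_bop_poly_ge\<close>): if \<open>m \<le> p\<close> on the real spectrum of \<open>T\<close>, then
  \<open>m \<le> p(T)\<close>.  The best lower bound \<open>l\<close> of a self-adjoint operator is a spectral value of it
  (\<open>real_spectrum_lower_edge\<close>); for \<open>p(T)\<close>, the factorisation of \<open>p - l\<close> over the reals then yields a
  point of the spectrum of \<open>T\<close> where \<open>p\<close> takes the value \<open>l\<close>
  (\<open>root_in_real_spectrum\<close>), so that \<open>m \<le> l\<close>.
\<close>


section \<open>Operators as a normed algebra\<close>

instance bop :: (complex_hilbert) real_normed_algebra
proof
  fix r :: real and S T :: "'a bop"
  show "r *\<^sub>R S * T = r *\<^sub>R (S * T)"
    by (rule bop_eqI) simp
  show "S * r *\<^sub>R T = r *\<^sub>R (S * T)"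
    by (rule bop_eqI) (simp add: bop_apply_linear flip: scaleC_of_real)
  show "norm (S * T) \<le> norm S * norm T"
    by transfer (rule norm_blinfun_compose)
qed

lemma norm_bop_le:
  assumes "0 \<le> b" "\<And>x. norm (bop_apply T x) \<le> b * norm x"
  shows "norm T \<le> b"
  using assms by transfer (rule norm_blinfun_bound)

lemma norm_bop_one_le: "norm (1 :: 'a::complex_hilbert bop) \<le> 1"
  by (rule norm_bop_le) simp_all

definition bop_invertible :: "'a::complex_hilbert bop \<Rightarrow> bool"
  where "bop_invertible T \<longleftrightarrow> (\<exists>S. S * T = 1 \<and> T * S = 1)"

lemma bop_invertible_mult:
  assumes "bop_invertible S" "bop_invertible T"
  shows "bop_invertible (S * T)"
proof -
  obtain S' T' where inv: "S' * S = 1" "S * S' = 1" "T' * T = 1" "T * T' = 1"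
    using assms unfolding bop_invertible_def by blast
  have "(T' * S') * (S * T) = T' * (S' * S) * T" "(S * T) * (T' * S') = S * (T * T') * S'"
    by (simp_all only: mult.assoc)
  then have "(T' * S') * (S * T) = 1" "(S * T) * (T' * S') = 1"
    by (simp_all add: inv)
  then show ?thesis
    unfolding bop_invertible_def by blast
qed

lemma bop_invertible_scaleR:
  assumes "bop_invertible T" "c \<noteq> 0"
  shows "bop_invertible (c *\<^sub>R T)"
proof -
  obtain S where "S * T = 1" "T * S = 1"
    using assms unfolding bop_invertible_def by blast
  then have "inverse c *\<^sub>R S * c *\<^sub>R T = 1" "c *\<^sub>R T * inverse c *\<^sub>R S = 1"
    using assms(2) by simp_all
  then show ?thesis
    unfolding bop_invertible_def by blast
qed

lemma bop_invertible_one: "bop_invertible 1"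
  unfolding bop_invertible_def by (intro exI [where x = 1]) simp

text \<open>The inverse is the Neumann series.\<close>

lemma bop_invertible_one_minus:
  fixes R :: "'a::complex_hilbert bop"
  assumes "norm R < 1"
  shows "bop_invertible (1 - R)"
proof -
  have norm_pow: "norm (R ^ n) \<le> norm R ^ n" for n
  proof (induction n)
    case (Suc n)
    have "norm (R ^ Suc n) \<le> norm R * norm (R ^ n)"
      by (simp add: norm_mult_ineq)
    also have "\<dots> \<le> norm R * norm R ^ n"
      by (rule mult_left_mono [OF Suc]) simp
    finally show ?case by simp
  qed (simp add: norm_bop_one_le)
  have "summable (\<lambda>n. R ^ n)"
  proof (rule summable_comparison_test' [where N = 0])
    show "summable (\<lambda>n. norm R ^ n)"
      using assms by (simp add: summable_geometric)
  qed (rule norm_pow)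
  then have sums: "(\<lambda>n. \<Sum>k<n. R ^ k) \<longlonglongrightarrow> (\<Sum>n. R ^ n)" (is "_ \<longlonglongrightarrow> ?S")
    by (simp add: summable_LIMSEQ)
  have "(\<lambda>n. R ^ n) \<longlonglongrightarrow> 0"
    using \<open>summable (\<lambda>n. R ^ n)\<close> by (rule summable_LIMSEQ_zero)
  then have one: "(\<lambda>n. 1 - R ^ n) \<longlonglongrightarrow> 1"
    using tendsto_diff [OF tendsto_const [of "1 :: 'a bop"]] by fastforce
  have left: "(1 - R) * (\<Sum>k<n. R ^ k) = 1 - R ^ n" for n
    by (induction n) (simp_all add: distrib_left left_diff_distrib)
  have right: "(\<Sum>k<n. R ^ k) * (1 - R) = 1 - R ^ n" for n
    using left [of n]
    by (simp add: left_diff_distrib right_diff_distrib sum_distrib_left sum_distrib_right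
        sum_subtractf power_commutes)
  have "(\<lambda>n. (1 - R) * (\<Sum>k<n. R ^ k)) \<longlonglongrightarrow> (1 - R) * ?S"
    "(\<lambda>n. (\<Sum>k<n. R ^ k) * (1 - R)) \<longlonglongrightarrow> ?S * (1 - R)"
    by (intro tendsto_mult tendsto_const sums)+
  then have "(1 - R) * ?S = 1" "?S * (1 - R) = 1"
    unfolding left right using one LIMSEQ_unique by blast+
  then show ?thesis
    unfolding bop_invertible_def by blast
qed


section \<open>Self-adjoint operators and their quadratic forms\<close>

text \<open>For self-adjoint \<open>T\<close> the inner product \<open>\<langle>T x, x\<rangle>\<close> is real already; with the real part, the form is
  real-valued and linear in \<open>T\<close> for every operator.\<close>

definition qform :: "'a::complex_hilbert bop \<Rightarrow> 'a \<Rightarrow> real"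
  where "qform T x = Re (cinner (bop_apply T x) x)"

lemma cinner_scaleR_left: "cinner (r *\<^sub>R x) y = of_real r * cinner x (y::'a::complex_inner)"
  by (simp add: cinner_scaleC_left flip: scaleC_of_real)

lemma cinner_diff_left: "cinner (x - y) z = cinner x z - cinner y (z::'a::complex_inner)"
  using cinner_add_left [of "x - y" y z] by simp

lemma Re_cinner_commute: "Re (cinner x y) = Re (cinner y (x::'a::complex_inner))"
  by (subst cinner_commute) simp

lemma bop_apply_diff: "bop_apply T (x - y) = bop_apply T x - bop_apply T y"
  by (rule linear_diff [OF bounded_linear.linear [OF bounded_linear_bop_apply]])

lemma bop_apply_scaleR: "bop_apply T (r *\<^sub>R x) = r *\<^sub>R bop_apply T x"
  by (rule linear_cmul [OF bounded_linear.linear [OF bounded_linear_bop_apply]])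

lemma qform_add: "qform (S + T) x = qform S x + qform T x"
  and qform_diff: "qform (S - T) x = qform S x - qform T x"
  and qform_scaleR: "qform (c *\<^sub>R T) x = c * qform T x"
  and qform_one: "qform 1 x = (norm x)\<^sup>2"
  by (simp_all add: qform_def cinner_add_left cinner_diff_left cinner_scaleR_left cinner_same
      del: of_real_power)

lemma abs_qform_le: "\<bar>qform T x\<bar> \<le> norm T * (norm x)\<^sup>2"
proof -
  have bound: "norm (bop_apply T x) * norm x \<le> norm T * (norm x)\<^sup>2"
    using mult_right_mono [OF bop_norm_apply [of T x], of "norm x"]
    by (simp add: power2_eq_square mult.assoc)
  have "- qform T x = Re (cinner (bop_apply T x) (- 1 *\<^sub>R x))"
    unfolding cinner_scaleR_right by (simp add: qform_def)
  also have "\<dots> \<le> norm (bop_apply T x) * norm x"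
    using Re_cinner_le [of "bop_apply T x" "- 1 *\<^sub>R x"] by simp
  finally show ?thesis
    using bound Re_cinner_le [of "bop_apply T x" x] by (simp add: qform_def)
qed

lemma bounded_linear_qform: "bounded_linear (\<lambda>T. qform T x)"
  by (rule bounded_linear_intro [where K = "(norm x)\<^sup>2"])
    (simp_all add: qform_add qform_scaleR abs_qform_le)

lemma cadjoint_eqI:
  assumes "\<And>x y. cinner (bop_apply T x) y = cinner x (bop_apply S y)"
  shows "cadjoint T = S"
proof (rule bop_eqI, rule cinner_right_eqI)
  show "cinner x (bop_apply (cadjoint T) y) = cinner x (bop_apply S y)" for x y
    using assms [of x y] cinner_cadjoint [of T x y] by simp
qed

lemma selfadjoint_iff:
  "selfadjoint T \<longleftrightarrow> (\<forall>x y. cinner (bop_apply T x) y = cinner x (bop_apply T y))"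
proof
  show "selfadjoint T \<Longrightarrow> \<forall>x y. cinner (bop_apply T x) y = cinner x (bop_apply T y)"
    unfolding selfadjoint_def using cinner_cadjoint [of T] by simp
  show "\<forall>x y. cinner (bop_apply T x) y = cinner x (bop_apply T y) \<Longrightarrow> selfadjoint T"
    unfolding selfadjoint_def by (rule cadjoint_eqI) blast
qed

lemma selfadjoint_one: "selfadjoint 1"
  by (simp add: selfadjoint_iff)

lemma selfadjoint_add: "selfadjoint S \<Longrightarrow> selfadjoint T \<Longrightarrow> selfadjoint (S + T)"
  and selfadjoint_diff: "selfadjoint S \<Longrightarrow> selfadjoint T \<Longrightarrow> selfadjoint (S - T)"
  and selfadjoint_scaleR: "selfadjoint T \<Longrightarrow> selfadjoint (c *\<^sub>R T)"
  unfolding selfadjoint_iff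
  by (simp_all add: cinner_add_left cinner_add_right cinner_diff_left cinner_diff_right
      cinner_scaleR_left cinner_scaleR_right)

lemma selfadjoint_power:
  assumes "selfadjoint T"
  shows "selfadjoint (T ^ n)"
proof (induction n)
  case 0
  then show ?case
    by (simp add: selfadjoint_one)
next
  case (Suc n)
  have "cinner (bop_apply (T ^ Suc n) x) y = cinner x (bop_apply (T ^ Suc n) y)" for x y
  proof -
    have "cinner (bop_apply (T ^ Suc n) x) y = cinner x (bop_apply (T ^ n * T) y)"
      using assms Suc by (simp add: selfadjoint_iff)
    then show ?thesis
      by (simp only: power_commutes power_Suc)
  qed
  then show ?case
    unfolding selfadjoint_iff by blast
qed

lemma qform_square:
  assumes "selfadjoint T"
  shows "qform (T\<^sup>2) x = (norm (bop_apply T x))\<^sup>2"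
proof -
  have "cinner (bop_apply T (bop_apply T x)) x = cinner (bop_apply T x) (bop_apply T x)"
    using assms by (simp add: selfadjoint_iff)
  then show ?thesis
    by (simp add: qform_def power2_eq_square cinner_same)
qed

text \<open>The norm of a self-adjoint operator is its numerical radius.  The polarisation identity
  bounds \<open>\<langle>S x, y\<rangle>\<close> by \<open>m (\<parallel>x\<parallel>\<^sup>2 + \<parallel>y\<parallel>\<^sup>2) / 2\<close>, and the bound on \<open>\<parallel>S x\<parallel>\<close> comes from the \<open>y\<close>
  in the direction of \<open>S x\<close> that is as long as \<open>x\<close>.\<close>

lemma norm_selfadjoint_le:
  assumes S: "selfadjoint S" and m: "0 \<le> m" "\<And>x. \<bar>qform S x\<bar> \<le> m * (norm x)\<^sup>2"
  shows "norm S \<le> m"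
proof (rule norm_bop_le [OF m(1)])
  have polar: "2 * Re (cinner (bop_apply S x) y) \<le> m * ((norm x)\<^sup>2 + (norm y)\<^sup>2)" for x y
  proof -
    have "Re (cinner (bop_apply S y) x) = Re (cinner (bop_apply S x) y)"
      using S unfolding selfadjoint_iff by (metis Re_cinner_commute)
    then have "4 * Re (cinner (bop_apply S x) y) = qform S (x + y) - qform S (x - y)"
      by (simp add: qform_def bop_apply_linear bop_apply_diff cinner_add_left cinner_add_right
          cinner_diff_left cinner_diff_right)
    also have "\<dots> \<le> m * (norm (x + y))\<^sup>2 + m * (norm (x - y))\<^sup>2"
      using m(2) [of "x + y"] m(2) [of "x - y"] by linarith
    also have "\<dots> = m * ((norm (x - y))\<^sup>2 + (norm (x + y))\<^sup>2)"
      by (simp only: distrib_left add.commute)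
    also have "\<dots> = m * (2 * (norm x)\<^sup>2 + 2 * (norm y)\<^sup>2)"
      by (simp only: norm_parallelogram)
    finally show ?thesis
      by (simp add: algebra_simps)
  qed
  show "norm (bop_apply S x) \<le> m * norm x" for x
  proof (cases "bop_apply S x = 0 \<or> x = 0")
    case True
    then show ?thesis
      using m(1) linear_0 [OF bounded_linear.linear [OF bounded_linear_bop_apply [of S]]] by auto
  next
    case False
    define n where "n = norm (bop_apply S x)"
    have "n > 0" "norm x > 0"
      using False by (simp_all add: n_def)
    define y where "y = (norm x / n) *\<^sub>R bop_apply S x"
    have "Re (cinner (bop_apply S x) y) = norm x * n" "norm y = norm x"
      using \<open>n > 0\<close> unfolding y_def cinner_scaleR_right cinner_same
      by (simp_all add: n_def power2_eq_square)
    then have "2 * (norm x * n) \<le> m * ((norm x)\<^sup>2 + (norm x)\<^sup>2)"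
      using polar [of x y] by simp
    then have "norm x * n \<le> norm x * (m * norm x)"
      by (simp add: power2_eq_square algebra_simps)
    then show ?thesis
      using \<open>norm x > 0\<close> by (simp add: n_def)
  qed
qed

text \<open>A positive operator is invertible exactly when it is bounded below by a positive constant;
  this lemma and the next are the two directions.  Here, rescaling makes \<open>1 - S / K\<close> a strict
  contraction.\<close>

lemma bop_invertible_of_coercive:
  assumes S: "selfadjoint S" and c: "0 < c" "\<And>x. c * (norm x)\<^sup>2 \<le> qform S x"
  shows "bop_invertible S"
proof -
  define K where "K = norm S + c"
  have K: "0 < K" "c \<le> K"
    using c by (simp_all add: K_def add_nonneg_pos)
  define R where "R = 1 - (1 / K) *\<^sub>R S"
  have "norm R \<le> 1 - c / K"
  proof (rule norm_selfadjoint_le)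
    show "selfadjoint R"
      unfolding R_def by (intro selfadjoint_diff selfadjoint_scaleR selfadjoint_one S)
    show "0 \<le> 1 - c / K"
      using K by simp
    show "\<bar>qform R x\<bar> \<le> (1 - c / K) * (norm x)\<^sup>2" for x
    proof -
      have "qform S x \<le> K * (norm x)\<^sup>2"
        using abs_qform_le [of S x] c(1) unfolding K_def
        by (smt (verit) distrib_right mult_nonneg_nonneg zero_le_power2)
      then have "0 \<le> qform R x" "qform R x \<le> (1 - c / K) * (norm x)\<^sup>2"
        using K(1) c(2) [of x]
        by (simp_all add: R_def qform_diff qform_scaleR qform_one field_simps)
      then show ?thesis
        by simp
    qed
  qed
  then have "norm R < 1"
    using K(1) c(1) by (smt (verit) divide_pos_pos)
  then have "bop_invertible (K *\<^sub>R (1 - R))"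
    using K by (intro bop_invertible_scaleR bop_invertible_one_minus) simp_all
  then show ?thesis
    using K(1) by (simp add: R_def)
qed

text \<open>Positivity of \<open>P\<close> at \<open>x - P x / K\<close> gives \<open>\<parallel>P x\<parallel>\<^sup>2 \<le> K \<langle>P x, x\<rangle>\<close> whenever \<open>\<parallel>P\<parallel> \<le> K\<close>, so the
  quadratic form of \<open>P\<close> controls \<open>\<parallel>P x\<parallel>\<close>, and through the inverse it controls \<open>\<parallel>x\<parallel>\<close>.\<close>

lemma coercive_of_bop_invertible:
  assumes P: "selfadjoint P" "\<And>x. 0 \<le> qform P x" and inv: "bop_invertible P"
  shows "\<exists>c>0. \<forall>x. c * (norm x)\<^sup>2 \<le> qform P x"
proof -
  obtain R where R: "R * P = 1"
    using inv unfolding bop_invertible_def by blast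
  define K where "K = norm P + 1"
  define L where "L = norm R + 1"
  have "0 < K" "norm P \<le> K" "0 < L" "norm R \<le> L"
    by (simp_all add: K_def L_def add_nonneg_pos)
  have image: "(norm (bop_apply P x))\<^sup>2 \<le> K * qform P x" for x
  proof -
    define y where "y = bop_apply P x"
    have cross: "Re (cinner (bop_apply P y) x) = (norm y)\<^sup>2" "Re (cinner (bop_apply P x) y) = (norm y)\<^sup>2"
      using P(1) unfolding selfadjoint_iff by (simp_all add: y_def cinner_same del: of_real_power)
    have "0 \<le> qform P (x - (1 / K) *\<^sub>R y)"
      by (rule P(2))
    also have "\<dots> = qform P x - 2 * (norm y)\<^sup>2 / K + qform P y / K\<^sup>2"
      using \<open>0 < K\<close> cross unfolding qform_def
      by (simp add: bop_apply_diff bop_apply_scaleR cinner_diff_left cinner_diff_right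
          cinner_scaleR_left cinner_scaleR_right power2_eq_square diff_divide_distrib)
    also have "qform P y / K\<^sup>2 \<le> K * (norm y)\<^sup>2 / K\<^sup>2"
    proof (rule divide_right_mono)
      have "norm P * (norm y)\<^sup>2 \<le> K * (norm y)\<^sup>2"
        using \<open>norm P \<le> K\<close> by (rule mult_right_mono) simp
      then show "qform P y \<le> K * (norm y)\<^sup>2"
        using abs_qform_le [of P y] by linarith
    qed simp
    also have "K * (norm y)\<^sup>2 / K\<^sup>2 = (norm y)\<^sup>2 / K"
      using \<open>0 < K\<close> by (simp add: power2_eq_square)
    finally show ?thesis
      using \<open>0 < K\<close> by (simp add: y_def field_simps)
  qed
  have "1 / (L\<^sup>2 * K) * (norm x)\<^sup>2 \<le> qform P x" for x
  proof -
    have "bop_apply R (bop_apply P x) = x"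
      using R by (metis bop_apply_simps(2,7))
    then have "norm x \<le> norm R * norm (bop_apply P x)"
      using bop_norm_apply by metis
    also have "\<dots> \<le> L * norm (bop_apply P x)"
      by (rule mult_right_mono [OF \<open>norm R \<le> L\<close>]) simp
    finally have "(norm x)\<^sup>2 \<le> (L * norm (bop_apply P x))\<^sup>2"
      by (rule power_mono) simp
    then have "(norm x)\<^sup>2 \<le> L\<^sup>2 * (norm (bop_apply P x))\<^sup>2"
      by (simp only: power_mult_distrib)
    also have "\<dots> \<le> L\<^sup>2 * (K * qform P x)"
      by (intro mult_left_mono image) simp
    finally show ?thesis
      using \<open>0 < K\<close> \<open>0 < L\<close> by (simp add: field_simps)
  qed
  moreover have "1 / (L\<^sup>2 * K) > 0"
    using \<open>0 < K\<close> \<open>0 < L\<close> by simp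
  ultimately show ?thesis
    by blast
qed


section \<open>Polynomials of a self-adjoint operator\<close>

text \<open>An abbreviation, because this set occurs verbatim in the definition of
  \<open>functional_calculus\<close>.\<close>

abbreviation real_spectrum :: "'a::complex_hilbert bop \<Rightarrow> real set"
  where "real_spectrum T \<equiv> {t. complex_of_real t \<in> spectrum T}"

lemma real_spectrum_iff: "t \<in> real_spectrum T \<longleftrightarrow> \<not> bop_invertible (T - t *\<^sub>R 1)"
  by (simp add: spectrum_def bop_invertible_def scaleC_of_real)

lemma bop_poly_eq_sum:
  assumes "degree p \<le> n"
  shows "bop_poly p T = (\<Sum>i\<le>n. coeff p i *\<^sub>R T ^ i)"
  unfolding bop_poly_def using assms
  by (intro sum.mono_neutral_left) (auto simp: coeff_eq_0)

lemma bop_poly_pCons: "bop_poly (pCons a p) T = a *\<^sub>R 1 + T * bop_poly p T"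
proof -
  have "bop_poly (pCons a p) T = (\<Sum>i\<le>Suc (degree p). coeff (pCons a p) i *\<^sub>R T ^ i)"
    by (rule bop_poly_eq_sum) (rule degree_pCons_le)
  also have "\<dots> = a *\<^sub>R 1 + (\<Sum>i\<le>degree p. coeff p i *\<^sub>R T ^ Suc i)"
    by (subst sum.atMost_Suc_shift) (simp del: power_Suc)
  finally show ?thesis
    by (simp add: bop_poly_def sum_distrib_left)
qed

lemma bop_poly_zero: "bop_poly 0 T = 0"
  by (simp add: bop_poly_def)

lemma bop_poly_const: "bop_poly [:a:] T = a *\<^sub>R 1"
  and bop_poly_linear: "bop_poly [:a, b:] T = a *\<^sub>R 1 + b *\<^sub>R T"
  by (simp_all add: bop_poly_pCons bop_poly_zero)

lemma bop_poly_add: "bop_poly (p + q) T = bop_poly p T + bop_poly q T"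
  by (induction p q rule: poly_induct2)
    (simp_all add: bop_poly_pCons bop_poly_zero scaleR_add_left distrib_left)

lemma bop_poly_smult: "bop_poly (smult c p) T = c *\<^sub>R bop_poly p T"
  by (induction p) (simp_all add: bop_poly_pCons bop_poly_zero scaleR_add_right)

lemma bop_poly_diff: "bop_poly (p - q) T = bop_poly p T - bop_poly q T"
  using bop_poly_add [of p "smult (- 1) q" T] unfolding bop_poly_smult by simp

lemma bop_poly_mult: "bop_poly (p * q) T = bop_poly p T * bop_poly q T"
  by (induction p)
    (simp_all add: bop_poly_pCons bop_poly_zero bop_poly_add bop_poly_smult distrib_right mult.assoc)

lemma selfadjoint_bop_poly:
  assumes "selfadjoint T"
  shows "selfadjoint (bop_poly p T)"
proof -
  have "selfadjoint (\<Sum>i\<le>n. coeff p i *\<^sub>R T ^ i)" for n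
    by (induction n)
      (simp_all add: assms selfadjoint_one selfadjoint_add selfadjoint_scaleR selfadjoint_power
        del: power_Suc)
  then show ?thesis
    by (simp add: bop_poly_def)
qed

text \<open>A non-real zero \<open>a + b \<i>\<close> of a real polynomial comes with its conjugate; together they
  contribute the factor \<open>(X - a)\<^sup>2 + b\<^sup>2\<close>.\<close>

lemma real_poly_factor:
  fixes p :: "real poly"
  assumes "degree p \<noteq> 0"
  obtains t where "[:- t, 1:] dvd p" | a b where "b \<noteq> 0" "[:- a, 1:]\<^sup>2 + [:b\<^sup>2:] dvd p"
proof -
  (* Evaluation at a complex number respects division with remainder of real polynomials. *)
  have hom: "poly (map_poly of_real (p * q + r)) z
      = poly (map_poly of_real p) z * poly (map_poly of_real q) z + poly (map_poly of_real r) (z::complex)"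
    for p q r :: "real poly" and z
  proof -
    have add: "poly (map_poly of_real (p + q)) z
        = poly (map_poly of_real p) z + poly (map_poly of_real q) z" for p q :: "real poly"
      by (induction p q rule: poly_induct2) (simp_all add: map_poly_pCons algebra_simps)
    have smult: "poly (map_poly of_real (smult c p)) z = of_real c * poly (map_poly of_real p) z"
      for c and p :: "real poly"
      by (induction p) (simp_all add: map_poly_pCons algebra_simps)
    show ?thesis
      unfolding add by (induction p) (simp_all add: map_poly_pCons add smult algebra_simps)
  qed
  let ?P = "map_poly complex_of_real p"
  have "degree ?P \<noteq> 0"
    using assms by (simp add: degree_map_poly)
  then obtain z where z: "poly ?P z = 0"
    using fundamental_theorem_of_algebra [of ?P] constant_degree [of ?P] by auto
  define a b where "a = Re z" and "b = Im z"
  show thesis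
  proof (cases "b = 0")
    case True
    then have "z = of_real a"
      by (simp add: a_def b_def complex_eq_iff)
    moreover have "poly ?P (of_real a) = of_real (poly p a)"
      by (induction p) (simp_all add: map_poly_pCons)
    ultimately have "poly p a = 0"
      using z by simp
    then show thesis
      by (intro that(1) [of a]) (simp add: poly_eq_0_iff_dvd)
  next
    case False
    define q where "q = [:- a, 1:]\<^sup>2 + [:b\<^sup>2:]"
    have q: "q = [:a\<^sup>2 + b\<^sup>2, - 2 * a, 1:]"
      by (simp add: q_def power2_eq_square)
    have "poly (map_poly of_real q) z = 0"
      by (simp add: q map_poly_pCons complex_eq_iff a_def b_def power2_eq_square algebra_simps)
    then have root: "poly (map_poly of_real (p mod q)) z = 0"
      using hom [of q "p div q" "p mod q" z] z by simp
    have "degree (p mod q) < 2"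
      using degree_mod_less [of q p] by (auto simp: q)
    moreover define c d where "c = coeff (p mod q) 0" and "d = coeff (p mod q) 1"
    ultimately have cd: "p mod q = [:c, d:]"
      by (intro poly_eqI) (auto simp: coeff_pCons coeff_eq_0 split: nat.split)
    have "d * b = 0" "c + d * a = 0"
      using root unfolding cd by (auto simp: map_poly_pCons complex_eq_iff a_def b_def algebra_simps)
    (* A real polynomial of degree at most 1 with a non-real zero vanishes. *)
    then have "p mod q = 0"
      using False cd by simp
    then show thesis
      using that(2) [of b a] False by (simp add: q_def mod_eq_0_iff_dvd)
  qed
qed

text \<open>Over the reals a polynomial factors into linear and irreducible quadratic polynomials, and
  the quadratic factors become coercive, hence invertible, operators.\<close>

lemma root_in_real_spectrum:
  fixes T :: "'a::complex_hilbert bop"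
  assumes T: "selfadjoint T" and "p \<noteq> 0" "\<not> bop_invertible (bop_poly p T)"
  shows "\<exists>t\<in>real_spectrum T. poly p t = 0"
  using assms(2,3)
proof (induction "degree p" arbitrary: p rule: less_induct)
  case less
  show ?case
  proof (cases "degree p = 0")
    case True
    then obtain a where "p = [:a:]"
      by (rule degree_eq_zeroE)
    then show ?thesis
      using less.prems bop_invertible_scaleR [OF bop_invertible_one [where ?'a = 'a], of a]
      by (simp add: bop_poly_const)
  next
    case False
    then show ?thesis
    proof (cases rule: real_poly_factor)
      case (1 t)
      then obtain q where q: "p = [:- t, 1:] * q"
        by (elim dvdE)
      have lin: "bop_poly [:- t, 1:] T = T - t *\<^sub>R 1"
        by (simp add: bop_poly_linear)
      show ?thesis
      proof (cases "bop_invertible (T - t *\<^sub>R 1)")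
        case True
        then have "\<not> bop_invertible (bop_poly q T)"
          using less.prems(2) bop_invertible_mult unfolding q bop_poly_mult lin by blast
        moreover have "q \<noteq> 0"
          using less.prems(1) q by auto
        moreover from this have "degree q < degree p"
          unfolding q by (simp add: degree_mult_eq del: mult_pCons_left)
        ultimately show ?thesis
          using less.hyps [of q] q by auto
      next
        case False
        then show ?thesis
          using q real_spectrum_iff [of t T] by (intro bexI [of _ t]) auto
      qed
    next
      case (2 a b)
      define k where "k = [:- a, 1:]\<^sup>2 + [:b\<^sup>2:]"
      obtain q where q: "p = k * q"
        using 2(2) unfolding k_def by (elim dvdE)
      have "degree k = 2"
        by (simp add: k_def power2_eq_square)
      define S where "S = T - a *\<^sub>R 1"
      have S: "selfadjoint S"
        unfolding S_def by (intro selfadjoint_diff selfadjoint_scaleR selfadjoint_one T)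
      have "bop_poly k T = S\<^sup>2 + b\<^sup>2 *\<^sub>R 1"
        unfolding k_def power2_eq_square bop_poly_add bop_poly_mult
        by (simp add: bop_poly_linear bop_poly_const S_def)
      moreover have "bop_invertible (S\<^sup>2 + b\<^sup>2 *\<^sub>R 1)"
      proof (rule bop_invertible_of_coercive)
        show "selfadjoint (S\<^sup>2 + b\<^sup>2 *\<^sub>R 1)"
          by (intro selfadjoint_add selfadjoint_power selfadjoint_scaleR selfadjoint_one S)
        show "b\<^sup>2 * (norm x)\<^sup>2 \<le> qform (S\<^sup>2 + b\<^sup>2 *\<^sub>R 1) x" for x
          by (simp add: qform_add qform_scaleR qform_one qform_square [OF S])
      qed (use 2(1) in simp)
      ultimately have "\<not> bop_invertible (bop_poly q T)"
        using less.prems(2) bop_invertible_mult unfolding q bop_poly_mult by metis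
      moreover have "q \<noteq> 0" "k \<noteq> 0"
        using less.prems(1) unfolding q by auto
      then have "degree q < degree p"
        using \<open>degree k = 2\<close> unfolding q by (simp add: degree_mult_eq)
      ultimately show ?thesis
        using less.hyps [of q] \<open>q \<noteq> 0\<close> q by auto
    qed
  qed
qed

text \<open>The best lower bound of the quadratic form is a spectral value: otherwise \<open>Q - \<lambda>\<close> would be
  positive and invertible, hence coercive, and \<open>\<lambda>\<close> could be increased.\<close>

lemma real_spectrum_lower_edge:
  fixes Q :: "'a::complex_hilbert bop"
  assumes Q: "selfadjoint Q" and nontrivial: "u \<noteq> (0::'a)"
  shows "\<exists>l\<in>real_spectrum Q. \<forall>x. l * (norm x)\<^sup>2 \<le> qform Q x"
proof -
  define L where "L = {l. \<forall>x. l * (norm x)\<^sup>2 \<le> qform Q x}"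
  have "- norm Q \<in> L"
    using abs_qform_le [of Q] unfolding L_def by (simp add: abs_le_iff minus_le_iff)
  have "l \<le> qform Q u / (norm u)\<^sup>2" if "l \<in> L" for l
    using that nontrivial by (simp add: L_def pos_le_divide_eq)
  then have bdd: "bdd_above L"
    by (rule bdd_aboveI)
  define l where "l = Sup L"
  have lower: "l * (norm x)\<^sup>2 \<le> qform Q x" for x
  proof (cases "x = 0")
    case True
    then show ?thesis
      using abs_qform_le [of Q x] by simp
  next
    case False
    have "l \<le> qform Q x / (norm x)\<^sup>2"
      unfolding l_def
    proof (rule cSup_least)
      show "L \<noteq> {}"
        using \<open>- norm Q \<in> L\<close> by blast
      show "k \<le> qform Q x / (norm x)\<^sup>2" if "k \<in> L" for k
        using that False by (simp add: L_def pos_le_divide_eq)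
    qed
    then show ?thesis
      using False by (simp add: pos_le_divide_eq)
  qed
  have "\<not> bop_invertible (Q - l *\<^sub>R 1)"
  proof
    assume inv: "bop_invertible (Q - l *\<^sub>R 1)"
    have "selfadjoint (Q - l *\<^sub>R 1)"
      by (intro selfadjoint_diff selfadjoint_scaleR selfadjoint_one Q)
    moreover have form: "qform (Q - l *\<^sub>R 1) x = qform Q x - l * (norm x)\<^sup>2" for x
      by (simp add: qform_diff qform_scaleR qform_one)
    ultimately obtain c where c: "0 < c" "\<And>x. c * (norm x)\<^sup>2 \<le> qform Q x - l * (norm x)\<^sup>2"
      using coercive_of_bop_invertible [OF _ _ inv] lower by auto
    have "l + c \<in> L"
      unfolding L_def using c(2) by (simp add: distrib_right add.commute le_diff_eq)
    then have "l + c \<le> l"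
      unfolding l_def using bdd by (rule cSup_upper)
    with c(1) show False
      by simp
  qed
  then show ?thesis
    using lower real_spectrum_iff by blast
qed

text \<open>This is what the functional calculus rests on: the best lower bound \<open>l\<close> of the form of
  \<open>p(T)\<close> is a spectral value of \<open>p(T)\<close>, so that \<open>p - l\<close> vanishes somewhere on the spectrum of \<open>T\<close>.\<close>

lemma qform_bop_poly_ge:
  assumes T: "selfadjoint T" and m: "\<And>t. t \<in> real_spectrum T \<Longrightarrow> m \<le> poly p t"
  shows "m * (norm x)\<^sup>2 \<le> qform (bop_poly p T) x"
proof (cases "x = 0")
  case True
  then show ?thesis
    using abs_qform_le [of "bop_poly p T" x] by simp
next
  case False
  obtain l where l: "l \<in> real_spectrum (bop_poly p T)" "\<And>x. l * (norm x)\<^sup>2 \<le> qform (bop_poly p T) x"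
    using real_spectrum_lower_edge [OF selfadjoint_bop_poly [OF T] False] by blast
  have "\<exists>t\<in>real_spectrum T. poly p t = l"
  proof (cases "p - [:l:] = 0")
    case True
    then have "p = [:l:]"
      by simp
    then show ?thesis
      using real_spectrum_lower_edge [OF T False] by auto
  next
    case nonzero: False
    have "\<not> bop_invertible (bop_poly (p - [:l:]) T)"
      using l(1) unfolding real_spectrum_iff by (simp add: bop_poly_diff bop_poly_const)
    then show ?thesis
      using root_in_real_spectrum [OF T nonzero] by auto
  qed
  then have "m \<le> l"
    using m by blast
  then have "m * (norm x)\<^sup>2 \<le> l * (norm x)\<^sup>2"
    by (rule mult_right_mono) simp
  also have "\<dots> \<le> qform (bop_poly p T) x"
    by (rule l(2))
  finally show ?thesis .
qed

lemma norm_bop_poly_le: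
  assumes T: "selfadjoint T" and "0 \<le> M" "\<And>t. t \<in> real_spectrum T \<Longrightarrow> \<bar>poly p t\<bar> \<le> M"
  shows "norm (bop_poly p T) \<le> M"
proof (rule norm_selfadjoint_le)
  show "\<bar>qform (bop_poly p T) x\<bar> \<le> M * (norm x)\<^sup>2" for x
  proof -
    have "- M * (norm x)\<^sup>2 \<le> qform (bop_poly p T) x"
      by (rule qform_bop_poly_ge [OF T]) (use assms(3) in force)
    moreover have "- M * (norm x)\<^sup>2 \<le> qform (bop_poly (smult (- 1) p) T) x"
      by (rule qform_bop_poly_ge [OF T]) (use assms(3) in force)
    ultimately show ?thesis
      unfolding bop_poly_smult qform_scaleR by simp
  qed
qed (use assms in \<open>auto intro: selfadjoint_bop_poly\<close>)

text \<open>Outside bounds of the quotients \<open>\<langle>T x, x\<rangle> / \<parallel>x\<parallel>\<^sup>2\<close>, one of \<open>T - t\<close> and \<open>t - T\<close> is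
  coercive.\<close>

lemma real_spectrum_subset:
  assumes T: "selfadjoint T"
    and m: "\<And>x. m * (norm x)\<^sup>2 \<le> qform T x" and M: "\<And>x. qform T x \<le> M * (norm x)\<^sup>2"
  shows "real_spectrum T \<subseteq> {m..M}"
proof -
  have "bop_invertible (T - t *\<^sub>R 1)" if "t < m" for t
  proof (rule bop_invertible_of_coercive)
    show "selfadjoint (T - t *\<^sub>R 1)"
      by (intro selfadjoint_diff selfadjoint_scaleR selfadjoint_one T)
    show "(m - t) * (norm x)\<^sup>2 \<le> qform (T - t *\<^sub>R 1) x" for x
      using m [of x] by (simp add: qform_diff qform_scaleR qform_one left_diff_distrib)
  qed (use that in simp)
  moreover have "bop_invertible (T - t *\<^sub>R 1)" if "M < t" for t
  proof -
    have "bop_invertible (t *\<^sub>R 1 - T)"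
    proof (rule bop_invertible_of_coercive)
      show "selfadjoint (t *\<^sub>R 1 - T)"
        by (intro selfadjoint_diff selfadjoint_scaleR selfadjoint_one T)
      show "(t - M) * (norm x)\<^sup>2 \<le> qform (t *\<^sub>R 1 - T) x" for x
        using M [of x] by (simp add: qform_diff qform_scaleR qform_one left_diff_distrib)
    qed (use that in simp)
    then show ?thesis
      using bop_invertible_scaleR [of "t *\<^sub>R 1 - T" "- 1"] by simp
  qed
  ultimately show ?thesis
    using real_spectrum_iff [of _ T] by (auto simp: not_less [symmetric])
qed


section \<open>Continuous functional calculus\<close>

text \<open>The definite description in \<open>functional_calculus\<close> denotes: since \<open>\<parallel>p(T) - q(T)\<parallel>\<close> is at most the
  distance of \<open>p\<close> and \<open>q\<close> on the spectrum, any two approximating sequences of polynomials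
  have the same limit.  One such sequence is needed for uniqueness and is given here by \<open>p\<close>.\<close>

lemma functional_calculus_limit:
  fixes T :: "'a::complex_hilbert bop"
  assumes T: "selfadjoint T"
    and p: "uniform_limit (real_spectrum T) (\<lambda>n. poly (p n)) f sequentially"
  shows "(\<lambda>n. bop_poly (p n) T) \<longlonglongrightarrow> functional_calculus f T"
proof -
  have close: "\<exists>N. \<forall>m\<ge>N. \<forall>n\<ge>N. dist (bop_poly (p m) T) (bop_poly (q n) T) < e"
    if p: "uniform_limit (real_spectrum T) (\<lambda>n. poly (p n)) f sequentially"
      and q: "uniform_limit (real_spectrum T) (\<lambda>n. poly (q n)) f sequentially" and "0 < e"
    for p q and e :: real
  proof -
    obtain N where N: "\<And>n t. N \<le> n \<Longrightarrow> t \<in> real_spectrum T \<Longrightarrow> dist (poly (p n) t) (f t) < e / 3"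
      using uniform_limitD [OF p, of "e / 3"] \<open>0 < e\<close> unfolding eventually_sequentially by auto
    obtain N' where N': "\<And>n t. N' \<le> n \<Longrightarrow> t \<in> real_spectrum T \<Longrightarrow> dist (poly (q n) t) (f t) < e / 3"
      using uniform_limitD [OF q, of "e / 3"] \<open>0 < e\<close> unfolding eventually_sequentially by auto
    have "dist (bop_poly (p m) T) (bop_poly (q n) T) < e" if "max N N' \<le> m" "max N N' \<le> n" for m n
    proof -
      have "norm (bop_poly (p m - q n) T) \<le> 2 * e / 3"
      proof (rule norm_bop_poly_le [OF T])
        fix t assume "t \<in> real_spectrum T"
        then have "dist (poly (p m) t) (f t) < e / 3" "dist (poly (q n) t) (f t) < e / 3"
          using N N' that by simp_all
        then show "\<bar>poly (p m - q n) t\<bar> \<le> 2 * e / 3"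
          unfolding dist_real_def poly_diff by linarith
      qed (use \<open>0 < e\<close> in simp)
      then show ?thesis
        using \<open>0 < e\<close> by (simp add: dist_norm bop_poly_diff)
    qed
    then show ?thesis
      by blast
  qed
  have "Cauchy (\<lambda>n. bop_poly (p n) T)"
    using close [OF p p] by (rule metric_CauchyI)
  then obtain S where S: "(\<lambda>n. bop_poly (p n) T) \<longlonglongrightarrow> S"
    using Cauchy_convergent convergent_def by blast
  have all: "(\<lambda>n. bop_poly (q n) T) \<longlonglongrightarrow> S"
    if "uniform_limit (real_spectrum T) (\<lambda>n. poly (q n)) f sequentially" for q
  proof -
    have "(\<lambda>n. bop_poly (q n) T - bop_poly (p n) T) \<longlonglongrightarrow> 0"
      using close [OF that p] by (fastforce simp: LIMSEQ_def dist_norm)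
    from tendsto_add [OF this S] show ?thesis
      by simp
  qed
  have "functional_calculus f T = S"
    unfolding functional_calculus_def
  proof (rule the_equality)
    show "\<forall>q. uniform_limit (real_spectrum T) (\<lambda>n. poly (q n)) f sequentially \<longrightarrow>
        (\<lambda>n. bop_poly (q n) T) \<longlonglongrightarrow> S"
      using all by blast
    show "S' = S" if "\<forall>q. uniform_limit (real_spectrum T) (\<lambda>n. poly (q n)) f sequentially \<longrightarrow>
        (\<lambda>n. bop_poly (q n) T) \<longlonglongrightarrow> S'" for S'
      using that p S LIMSEQ_unique by blast
  qed
  with S show ?thesis
    by simp
qed

lemma Weierstrass_poly:
  fixes f :: "real \<Rightarrow> real"
  assumes "continuous_on {a..b} f" "0 < e"
  shows "\<exists>p. \<forall>t\<in>{a..b}. \<bar>poly p t - f t\<bar> < e"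
proof -
  obtain g where g: "real_polynomial_function g" "\<And>t. t \<in> {a..b} \<Longrightarrow> \<bar>f t - g t\<bar> < e"
    using Stone_Weierstrass_real_polynomial_function [of "{a..b}" f e] assms by auto
  obtain c n where "g = (\<lambda>t. \<Sum>i\<le>n. c i * t ^ i)"
    using g(1) real_polynomial_function_iff_sum by blast
  then have "poly (\<Sum>i\<le>n. monom (c i) i) t = g t" for t
    by (simp add: poly_sum poly_monom)
  with g(2) show ?thesis
    by (intro exI [of _ "\<Sum>i\<le>n. monom (c i) i"]) (simp add: abs_minus_commute)
qed

text \<open>All later properties of the functional calculus are read off from this error bound: replacing
  \<open>f\<close> by a polynomial costs no more in norm than it does uniformly on the spectrum.\<close>

lemma functional_calculus_error:
  fixes T :: "'a::complex_hilbert bop"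
  assumes T: "selfadjoint T" "real_spectrum T \<subseteq> {a..b}" and f: "continuous_on {a..b} f"
    and e: "0 \<le> e" "\<And>t. t \<in> real_spectrum T \<Longrightarrow> \<bar>poly q t - f t\<bar> \<le> e"
  shows "norm (bop_poly q T - functional_calculus f T) \<le> e"
proof -
  have "\<exists>p. \<forall>t\<in>{a..b}. \<bar>poly p t - f t\<bar> < inverse (real (Suc n))" for n
    by (rule Weierstrass_poly [OF f]) simp
  then obtain p where p: "\<And>n t. t \<in> {a..b} \<Longrightarrow> \<bar>poly (p n) t - f t\<bar> < inverse (real (Suc n))"
    by metis
  have "uniform_limit (real_spectrum T) (\<lambda>n. poly (p n)) f sequentially"
  proof (rule uniform_limitI)
    fix e' :: real
    assume "0 < e'"
    have "\<forall>\<^sub>F n in sequentially. inverse (real (Suc n)) < e'"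
      using LIMSEQ_inverse_real_of_nat \<open>0 < e'\<close> by (rule order_tendstoD)
    then show "\<forall>\<^sub>F n in sequentially. \<forall>t\<in>real_spectrum T. dist (poly (p n) t) (f t) < e'"
    proof eventually_elim
      case (elim n)
      show ?case
      proof
        fix t assume "t \<in> real_spectrum T"
        then show "dist (poly (p n) t) (f t) < e'"
          using p [of t n] elim T(2) by (auto simp: dist_real_def)
      qed
    qed
  qed
  then have lim: "(\<lambda>n. norm (bop_poly q T - bop_poly (p n) T))
      \<longlonglongrightarrow> norm (bop_poly q T - functional_calculus f T)"
    by (intro tendsto_intros functional_calculus_limit T)
  have "norm (bop_poly q T - bop_poly (p n) T) \<le> e + inverse (real (Suc n))" for n
    unfolding bop_poly_diff [symmetric]
  proof (rule norm_bop_poly_le [OF T(1)])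
    show "0 \<le> e + inverse (real (Suc n))"
      using e(1) by simp
    fix t assume t: "t \<in> real_spectrum T"
    then have "t \<in> {a..b}"
      using T(2) by blast
    then show "\<bar>poly (q - p n) t\<bar> \<le> e + inverse (real (Suc n))"
      using p [of t n] e(2) [OF t] by simp
  qed
  moreover have "(\<lambda>n. e + inverse (real (Suc n))) \<longlonglongrightarrow> e + 0"
    by (intro tendsto_add tendsto_const LIMSEQ_inverse_real_of_nat)
  ultimately show ?thesis
    using LIMSEQ_le [OF lim] by auto
qed

lemma functional_calculus_poly:
  assumes "selfadjoint T" "real_spectrum T \<subseteq> {a..b}" "continuous_on {a..b} f"
    and "\<And>t. t \<in> real_spectrum T \<Longrightarrow> f t = poly p t"
  shows "functional_calculus f T = bop_poly p T"
  using functional_calculus_error [OF assms(1-3), of 0 p] assms(4) by simp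

lemma norm_functional_calculus_le:
  assumes "selfadjoint T" "real_spectrum T \<subseteq> {a..b}" "continuous_on {a..b} f"
    and "0 \<le> M" "\<And>t. t \<in> real_spectrum T \<Longrightarrow> \<bar>f t\<bar> \<le> M"
  shows "norm (functional_calculus f T) \<le> M"
  using functional_calculus_error [OF assms(1-4), of 0] assms(5) by (simp add: bop_poly_zero)

lemma qform_functional_calculus_ge:
  assumes T: "selfadjoint T" "real_spectrum T \<subseteq> {a..b}" and f: "continuous_on {a..b} f"
    and le: "\<And>t. t \<in> real_spectrum T \<Longrightarrow> poly q t \<le> f t"
  shows "qform (bop_poly q T) x \<le> qform (functional_calculus f T) x"
proof -
  have *: "qform (bop_poly q T) x - qform (functional_calculus f T) x \<le> e * (2 * (norm x)\<^sup>2)"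
    if "0 < e" for e
  proof -
    obtain p where p: "\<And>t. t \<in> {a..b} \<Longrightarrow> \<bar>poly p t - f t\<bar> < e"
      using Weierstrass_poly [OF f \<open>0 < e\<close>] by blast
    have "- e * (norm x)\<^sup>2 \<le> qform (bop_poly (p - q) T) x"
    proof (rule qform_bop_poly_ge [OF T(1)])
      fix t assume t: "t \<in> real_spectrum T"
      then show "- e \<le> poly (p - q) t"
        using p [of t] le [OF t] T(2) by (auto simp: abs_if split: if_splits)
    qed
    moreover have "norm (bop_poly p T - functional_calculus f T) \<le> e"
    proof (rule functional_calculus_error [OF T f])
      show "\<bar>poly p t - f t\<bar> \<le> e" if "t \<in> real_spectrum T" for t
        using p [of t] that T(2) by (auto intro: less_imp_le)
    qed (use \<open>0 < e\<close> in simp)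
    then have "norm (bop_poly p T - functional_calculus f T) * (norm x)\<^sup>2 \<le> e * (norm x)\<^sup>2"
      by (rule mult_right_mono) simp
    then have "qform (bop_poly p T - functional_calculus f T) x \<le> e * (norm x)\<^sup>2"
      using abs_qform_le [of "bop_poly p T - functional_calculus f T" x] by linarith
    ultimately show ?thesis
      by (simp add: bop_poly_diff qform_diff)
  qed
  (* The summand 1 only keeps c positive when x = 0. *)
  define c where "c = 2 * (norm x)\<^sup>2 + 1"
  have "0 < c"
    by (simp add: c_def add_nonneg_pos)
  have "qform (bop_poly q T) x - qform (functional_calculus f T) x \<le> d" if "0 < d" for d
  proof -
    have "qform (bop_poly q T) x - qform (functional_calculus f T) x \<le> d / c * (2 * (norm x)\<^sup>2)"
      using that \<open>0 < c\<close> by (intro *) simp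
    also have "\<dots> \<le> d / c * c"
      using that \<open>0 < c\<close> by (intro mult_left_mono) (simp_all add: c_def)
    finally show ?thesis
      using \<open>0 < c\<close> by simp
  qed
  then show ?thesis
    using field_le_epsilon [of "qform (bop_poly q T) x" "qform (functional_calculus f T) x"]
    by (simp add: diff_le_eq add.commute)
qed

lemma continuous_on_bop_poly:
  fixes X :: "'b::topological_space \<Rightarrow> 'a::complex_hilbert bop"
  assumes "continuous_on S X"
  shows "continuous_on S (\<lambda>t. bop_poly p (X t))"
  unfolding bop_poly_def by (intro continuous_intros assms)

text \<open>The approximating polynomial depends only on the interval containing the spectra, so that
  \<open>f(X(t))\<close> is a uniform limit of polynomials in \<open>X(t)\<close>.\<close>

lemma continuous_on_functional_calculus:
  fixes X :: "'b::topological_space \<Rightarrow> 'a::complex_hilbert bop"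
  assumes X: "continuous_on S X" "\<And>s. s \<in> S \<Longrightarrow> selfadjoint (X s)"
      "\<And>s. s \<in> S \<Longrightarrow> real_spectrum (X s) \<subseteq> {a..b}"
    and f: "continuous_on {a..b} f"
  shows "continuous_on S (\<lambda>s. functional_calculus f (X s))"
proof -
  have "\<exists>p. \<forall>t\<in>{a..b}. \<bar>poly p t - f t\<bar> < inverse (real (Suc n))" for n
    by (rule Weierstrass_poly [OF f]) simp
  then obtain p where p: "\<And>n t. t \<in> {a..b} \<Longrightarrow> \<bar>poly (p n) t - f t\<bar> < inverse (real (Suc n))"
    by metis
  have error: "norm (bop_poly (p n) (X s) - functional_calculus f (X s)) \<le> inverse (real (Suc n))"
    if "s \<in> S" for n s
  proof (rule functional_calculus_error [OF X(2,3) [OF that] f])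
    show "\<bar>poly (p n) t - f t\<bar> \<le> inverse (real (Suc n))" if "t \<in> real_spectrum (X s)" for t
      using p [of t n] X(3) [OF \<open>s \<in> S\<close>] that by (auto intro: less_imp_le)
  qed simp
  show ?thesis
  proof (rule uniform_limit_theorem)
    show "\<forall>\<^sub>F n in sequentially. continuous_on S (\<lambda>s. bop_poly (p n) (X s))"
      by (simp add: continuous_on_bop_poly X(1))
    show "uniform_limit S (\<lambda>n s. bop_poly (p n) (X s)) (\<lambda>s. functional_calculus f (X s)) sequentially"
    proof (rule uniform_limitI)
      fix e :: real
      assume "0 < e"
      have "\<forall>\<^sub>F n in sequentially. inverse (real (Suc n)) < e"
        using LIMSEQ_inverse_real_of_nat \<open>0 < e\<close> by (rule order_tendstoD)
      then show "\<forall>\<^sub>F n in sequentially.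
          \<forall>s\<in>S. dist (bop_poly (p n) (X s)) (functional_calculus f (X s)) < e"
      proof eventually_elim
        case (elim n)
        then show ?case
          using error [of _ n] by (auto simp: dist_norm intro: le_less_trans)
      qed
    qed
  qed simp
qed


section \<open>Powers of positive operators\<close>

definition bop_positive :: "'a::complex_hilbert bop \<Rightarrow> bool"
  where "bop_positive T \<longleftrightarrow> selfadjoint T \<and> (\<forall>x. 0 \<le> qform T x)"

lemma bop_positive_square: "selfadjoint T \<Longrightarrow> bop_positive (T\<^sup>2)"
  by (simp add: bop_positive_def selfadjoint_power qform_square)

lemma bop_positive_combination:
  assumes "bop_positive P" "bop_positive Q" "0 \<le> a" "0 \<le> b"
  shows "bop_positive (a *\<^sub>R P + b *\<^sub>R Q)"
  using assms
  by (auto simp: bop_positive_def qform_add qform_scaleR intro: selfadjoint_add selfadjoint_scaleR)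

lemma real_spectrum_positive:
  assumes "bop_positive T" "norm T \<le> K"
  shows "real_spectrum T \<subseteq> {0..K}"
proof (rule real_spectrum_subset)
  show "qform T x \<le> K * (norm x)\<^sup>2" for x
    using abs_qform_le [of T x] mult_right_mono [OF assms(2), of "(norm x)\<^sup>2"] by simp
qed (use assms(1) in \<open>auto simp: bop_positive_def\<close>)

lemma continuous_on_powr_nonneg: "0 < r \<Longrightarrow> continuous_on {0..K::real} (\<lambda>t. t powr r)"
  by (rule continuous_on_powr') (auto intro: continuous_intros)

lemma norm_bop_powr_le:
  assumes T: "bop_positive T" "norm T \<le> K" and r: "0 < r"
  shows "norm (bop_powr T r) \<le> K powr r"
  unfolding bop_powr_def
proof (rule norm_functional_calculus_le [OF _ real_spectrum_positive [OF T]
      continuous_on_powr_nonneg [OF r]])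
  show "selfadjoint T"
    using T(1) by (simp add: bop_positive_def)
  show "\<bar>t powr r\<bar> \<le> K powr r" if "t \<in> real_spectrum T" for t
    using real_spectrum_positive [OF T] that r by (auto intro!: powr_mono2)
qed simp

lemma bop_powr_two:
  assumes T: "bop_positive T"
  shows "bop_powr T 2 = T\<^sup>2"
proof -
  have "bop_powr T 2 = bop_poly ([:0, 1:] * [:0, 1:]) T"
    unfolding bop_powr_def
  proof (rule functional_calculus_poly [OF _ real_spectrum_positive [OF T order_refl]
        continuous_on_powr_nonneg])
    show "selfadjoint T"
      using T by (simp add: bop_positive_def)
    show "t powr 2 = poly ([:0, 1:] * [:0, 1:]) t" if "t \<in> real_spectrum T" for t
      using real_spectrum_positive [OF T order_refl] that by (auto simp: power2_eq_square)
  qed simp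
  then show ?thesis
    by (simp only: bop_poly_mult bop_poly_linear) (simp add: power2_eq_square)
qed

text \<open>Bernoulli's inequality in homogeneous form: a convex function lies above its tangents.  The
  end point \<open>0\<close> lies outside the open half-line on which convexity is used.\<close>

lemma powr_ge_tangent:
  fixes r s t :: real
  assumes "1 \<le> r" "0 \<le> s" "0 \<le> t"
  shows "s powr r + r * s powr (r - 1) * (t - s) \<le> t powr r"
proof (cases "s = 0 \<or> t = 0")
  case True
  have "s powr r = s powr (r - 1) * s"
    using assms(1,2) powr_add [of s "r - 1" 1] by (cases "s = 0") simp_all
  then have "s powr r + r * s powr (r - 1) * (0 - s) = (1 - r) * s powr r"
    by (simp add: algebra_simps)
  moreover have "(1 - r) * s powr r \<le> 0"
    using assms(1) by (simp add: mult_nonpos_nonneg)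
  ultimately show ?thesis
    using True assms by auto
next
  case False
  then have "0 < s" "0 < t"
    using assms by auto
  have "r * s powr (r - 1) * (t - s) \<le> t powr r - s powr r"
  proof (rule convex_on_imp_above_tangent)
    show "convex_on {0<..} (\<lambda>x. x powr r)"
      by (rule powr_convex [OF assms(1)])
    show "((\<lambda>x. x powr r) has_real_derivative r * s powr (r - 1)) (at s within {0<..})"
      using \<open>0 < s\<close> by (auto intro!: derivative_eq_intros)
  qed (use \<open>0 < s\<close> \<open>0 < t\<close> in \<open>auto simp: interior_open\<close>)
  then show ?thesis
    by simp
qed

text \<open>The tangent in the preceding inequality is affine in \<open>t\<close>, so the functional calculus
  turns it into an operator inequality that can be averaged over operators that do not commute.\<close>

lemma qform_bop_powr_ge_tangent:
  assumes T: "bop_positive T" and "1 \<le> r" "0 \<le> s"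
  shows "s powr r * (norm x)\<^sup>2 + r * s powr (r - 1) * (qform T x - s * (norm x)\<^sup>2)
    \<le> qform (bop_powr T r) x"
proof -
  define q where "q = [:s powr r - r * s powr (r - 1) * s, r * s powr (r - 1):]"
  have q: "poly q t = s powr r + r * s powr (r - 1) * (t - s)" for t
    by (simp add: q_def algebra_simps)
  have "qform (bop_poly q T) x \<le> qform (functional_calculus (\<lambda>t. t powr r) T) x"
  proof (rule qform_functional_calculus_ge [OF _ real_spectrum_positive [OF T order_refl]
        continuous_on_powr_nonneg])
    show "selfadjoint T"
      using T by (simp add: bop_positive_def)
    show "poly q t \<le> t powr r" if "t \<in> real_spectrum T" for t
    proof -
      have "0 \<le> t"
        using real_spectrum_positive [OF T order_refl] that by auto
      then show ?thesis
        unfolding q by (rule powr_ge_tangent [OF assms(2,3)])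
    qed
  qed (use assms(2) in simp)
  then show ?thesis
    unfolding bop_powr_def q_def bop_poly_linear qform_add qform_scaleR qform_one
    by (simp add: algebra_simps)
qed


section \<open>Averaging powers along a segment\<close>

lemma norm_segment_le:
  fixes P Q :: "'a::real_normed_vector"
  assumes "norm P \<le> k" "norm Q \<le> k" "t \<in> {0..1}"
  shows "norm ((1 - t) *\<^sub>R P + t *\<^sub>R Q) \<le> k"
proof -
  have "norm ((1 - t) *\<^sub>R P + t *\<^sub>R Q) \<le> (1 - t) * norm P + t * norm Q"
    using norm_triangle_ineq [of "(1 - t) *\<^sub>R P" "t *\<^sub>R Q"] assms(3) by simp
  also have "\<dots> \<le> (1 - t) * k + t * k"
    using assms by (intro add_mono mult_left_mono) auto
  finally show ?thesis
    by (simp add: algebra_simps)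
qed

lemma continuous_on_bop_powr_segment:
  fixes P Q :: "'a::complex_hilbert bop"
  assumes P: "bop_positive P" and Q: "bop_positive Q" and r: "0 < r"
  shows "continuous_on {0..1} (\<lambda>t. bop_powr ((1 - t) *\<^sub>R P + t *\<^sub>R Q) r)"
  unfolding bop_powr_def
proof (rule continuous_on_functional_calculus)
  show "continuous_on {0..1} (\<lambda>t. (1 - t) *\<^sub>R P + t *\<^sub>R Q)"
    by (intro continuous_intros)
  show "continuous_on {0..max (norm P) (norm Q)} (\<lambda>t. t powr r)"
    by (rule continuous_on_powr_nonneg [OF r])
  fix t :: real assume t: "t \<in> {0..1}"
  then have pos: "bop_positive ((1 - t) *\<^sub>R P + t *\<^sub>R Q)"
    by (intro bop_positive_combination P Q) auto
  then show "selfadjoint ((1 - t) *\<^sub>R P + t *\<^sub>R Q)"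
    by (simp add: bop_positive_def)
  show "real_spectrum ((1 - t) *\<^sub>R P + t *\<^sub>R Q) \<subseteq> {0..max (norm P) (norm Q)}"
    by (rule real_spectrum_positive [OF pos norm_segment_le [OF _ _ t]]) simp_all
qed

lemma norm_integral_bop_powr_le:
  fixes P Q :: "'a::complex_hilbert bop"
  assumes P: "bop_positive P" "norm P \<le> k" and Q: "bop_positive Q" "norm Q \<le> k" and r: "0 < r"
  shows "norm (integral {0..1} (\<lambda>t. bop_powr ((1 - t) *\<^sub>R P + t *\<^sub>R Q) r)) \<le> k powr r"
proof -
  have "norm (bop_powr ((1 - t) *\<^sub>R P + t *\<^sub>R Q) r) \<le> k powr r" if "t \<in> {0..1}" for t
    using that P Q
    by (intro norm_bop_powr_le bop_positive_combination norm_segment_le r) auto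
  then have "norm (integral {0..1} (\<lambda>t. bop_powr ((1 - t) *\<^sub>R P + t *\<^sub>R Q) r)) \<le> k powr r * (1 - 0)"
    by (intro integral_bound continuous_on_bop_powr_segment P Q r) auto
  then show ?thesis
    by simp
qed

text \<open>An operator version of Jensen's inequality for the norm.  Both sides of the tangent inequality
  for \<open>X(t) = (1 - t) P + t Q\<close> are integrated over \<open>t\<close>.  Operator convexity of the power function,
  which fails for large \<open>r\<close>, is avoided because the point of tangency may depend on the vector at
  which the forms are evaluated.\<close>

lemma norm_average_powr_le:
  fixes P Q :: "'a::complex_hilbert bop"
  assumes P: "bop_positive P" and Q: "bop_positive Q" and r: "1 \<le> r"
  shows "norm ((1/2) *\<^sub>R (P + Q)) powr r
    \<le> norm (integral {0..1} (\<lambda>t. bop_powr ((1 - t) *\<^sub>R P + t *\<^sub>R Q) r))"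
proof -
  define M where "M = (1/2) *\<^sub>R (P + Q)"
  define X where "X t = (1 - t) *\<^sub>R P + t *\<^sub>R Q" for t
  define J where "J = integral {0..1} (\<lambda>t. bop_powr (X t) r)"
  have M: "bop_positive M"
    using bop_positive_combination [OF P Q, of "1/2" "1/2"] by (simp add: M_def scaleR_add_right)
  have X: "bop_positive (X t)" if "t \<in> {0..1}" for t
    using that unfolding X_def by (intro bop_positive_combination P Q) auto
  have "(\<lambda>t. bop_powr (X t) r) integrable_on {0..1}"
    unfolding X_def using r
    by (intro integrable_continuous_interval continuous_on_bop_powr_segment P Q) simp
  then have int_powr: "((\<lambda>t. qform (bop_powr (X t) r) x) has_integral qform J x) {0..1}" for x
    using has_integral_linear [OF integrable_integral bounded_linear_qform]
    unfolding J_def comp_def by blast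
  have int_X: "((\<lambda>t. qform (X t) x) has_integral qform M x) {0..1}" for x
  proof -
    have "((\<lambda>t. (1 - t) * qform P x + t * qform Q x) has_integral
        ((1 - 1\<^sup>2 / 2) * qform P x + 1\<^sup>2 / 2 * qform Q x)
        - ((0 - 0\<^sup>2 / 2) * qform P x + 0\<^sup>2 / 2 * qform Q x)) {0..1}"
      by (rule fundamental_theorem_of_calculus)
        (auto intro!: derivative_eq_intros simp flip: has_real_derivative_iff_has_vector_derivative)
    then show ?thesis
      unfolding X_def M_def qform_add qform_scaleR by (simp add: algebra_simps)
  qed
  have "norm M \<le> norm J powr (1 / r)"
  proof (rule norm_selfadjoint_le)
    show "selfadjoint M"
      using M by (simp add: bop_positive_def)
    show "\<bar>qform M x\<bar> \<le> norm J powr (1 / r) * (norm x)\<^sup>2" for x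
    proof (cases "x = 0")
      case True
      then show ?thesis
        using abs_qform_le [of M x] by simp
    next
      case False
      (* This s is the mean of the quotients qform (X t) x / norm x ^ 2 over the segment, so that
         the linear part of the tangent at s integrates to zero. *)
      define s where "s = qform M x / (norm x)\<^sup>2"
      have s: "0 \<le> s" "qform M x = s * (norm x)\<^sup>2"
        using M False by (simp_all add: s_def bop_positive_def)
      have const: "((\<lambda>t. k) has_integral k) {0..1::real}" for k :: real
        using has_integral_const_real [of k 0 1] by simp
      have "((\<lambda>t. s powr r * (norm x)\<^sup>2 + r * s powr (r - 1) * (qform (X t) x - s * (norm x)\<^sup>2))
          has_integral s powr r * (norm x)\<^sup>2
            + r * s powr (r - 1) * (qform M x - s * (norm x)\<^sup>2)) {0..1}"
        by (intro has_integral_add has_integral_mult_right has_integral_diff int_X const)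
      then have "((\<lambda>t. s powr r * (norm x)\<^sup>2 + r * s powr (r - 1) * (qform (X t) x - s * (norm x)\<^sup>2))
          has_integral s powr r * (norm x)\<^sup>2) {0..1}"
        by (simp add: s(2))
      then have "s powr r * (norm x)\<^sup>2 \<le> qform J x"
        by (rule has_integral_le [OF _ int_powr]) (rule qform_bop_powr_ge_tangent [OF X r s(1)])
      also have "\<dots> \<le> norm J * (norm x)\<^sup>2"
        using abs_qform_le [of J x] by simp
      finally have "s powr r \<le> norm J"
        using False by simp
      then have "(s powr r) powr (1 / r) \<le> norm J powr (1 / r)"
        using r by (intro powr_mono2) simp_all
      then have "s \<le> norm J powr (1 / r)"
        using r s(1) by (simp add: powr_powr)
      then have "s * (norm x)\<^sup>2 \<le> norm J powr (1 / r) * (norm x)\<^sup>2"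
        by (rule mult_right_mono) simp
      then show ?thesis
        using s by simp
    qed
  qed simp
  then have "norm M powr r \<le> (norm J powr (1 / r)) powr r"
    using r by (intro powr_mono2) simp_all
  also have "\<dots> = norm J"
    using r by (simp add: powr_powr)
  finally show ?thesis
    by (simp add: M_def J_def X_def)
qed


section \<open>The numerical radius and the Cartesian decomposition\<close>

lemma cmod_cinner_le: "cmod (cinner x y) \<le> norm x * norm (y::'a::complex_inner)"
proof -
  (* Rotating x by this phase makes the inner product real and non-negative. *)
  define c where "c = cnj (sgn (cinner x y))"
  have "cmod c \<le> 1"
    by (simp add: c_def norm_sgn)
  have "cnj (cinner x y) * cinner x y = (of_real (cmod (cinner x y)))\<^sup>2"
    by (metis complex_norm_square mult.commute of_real_power)
  then have "c * cinner x y = of_real (cmod (cinner x y))"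
    by (simp add: c_def sgn_eq power2_eq_square)
  then have "cmod (cinner x y) = Re (cinner (c *\<^sub>C x) y)"
    by (simp add: cinner_scaleC_left)
  also have "\<dots> \<le> norm (c *\<^sub>C x) * norm y"
    by (rule Re_cinner_le)
  also have "\<dots> \<le> norm x * norm y"
    using \<open>cmod c \<le> 1\<close> by (intro mult_right_mono) (simp_all add: norm_scaleC mult_left_le_one_le)
  finally show ?thesis .
qed

lemma cmod_cinner_le_numerical_radius:
  fixes x :: "'a::complex_hilbert"
  shows "cmod (cinner (bop_apply T x) x) \<le> numerical_radius T * (norm x)\<^sup>2"
proof (cases "x = 0")
  case True
  then show ?thesis
    using cmod_cinner_le [of "bop_apply T x" x] by simp
next
  case False
  have bdd: "bdd_above ((\<lambda>x. cmod (cinner (bop_apply T x) x)) ` {x. norm x = 1})"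
  proof (rule bdd_aboveI2)
    show "cmod (cinner (bop_apply T y) y) \<le> norm T" if "y \<in> {x. norm x = 1}" for y
      using cmod_cinner_le [of "bop_apply T y" y] bop_norm_apply [of T y] that by simp
  qed
  define u where "u = (1 / norm x) *\<^sub>R x"
  have "norm u = 1"
    using False by (simp add: u_def)
  then have "cmod (cinner (bop_apply T u) u) \<le> numerical_radius T"
    unfolding numerical_radius_def by (intro cSUP_upper bdd) simp
  moreover have "cmod (cinner (bop_apply T u) u) = cmod (cinner (bop_apply T x) x) / (norm x)\<^sup>2"
    by (simp add: u_def bop_apply_scaleR cinner_scaleR_left cinner_scaleR_right norm_mult norm_divide
        power2_eq_square)
  ultimately show ?thesis
    using False by (simp add: pos_divide_le_eq)
qed

lemma Im_cinner_selfadjoint: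
  assumes "selfadjoint T"
  shows "Im (cinner (bop_apply T x) x) = 0"
proof -
  have "cinner (bop_apply T x) x = cnj (cinner (bop_apply T x) x)"
    using assms cinner_commute [of x "bop_apply T x"] by (simp add: selfadjoint_iff)
  then show ?thesis
    by (metis cnj.simps(2) neg_equal_zero)
qed

lemma cinner_cartesian:
  assumes "selfadjoint B" "selfadjoint C"
  shows "cinner (bop_apply (B + \<i> *\<^sub>C C) x) x = Complex (qform B x) (qform C x)"
  using assms
  by (simp add: complex_eq_iff cinner_add_left cinner_scaleC_left qform_def Im_cinner_selfadjoint)

text \<open>The forms of \<open>B\<close> and \<open>C\<close> are the real and imaginary parts of
  \<open>\<langle>(B + \<i> C) x, x\<rangle>\<close>, and a self-adjoint operator is as large as its form.  On the zero space, where the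
  numerical radius is unspecified, \<open>0 \<le> w\<close> may fail; hence the vector \<open>u\<close>.\<close>

lemma norm_cartesian_le_numerical_radius:
  fixes B C :: "'a::complex_hilbert bop" and u :: 'a
  assumes BC: "selfadjoint B" "selfadjoint C" and "u \<noteq> 0"
  defines "w \<equiv> numerical_radius (B + \<i> *\<^sub>C C)"
  shows "0 \<le> w" "norm B \<le> w" "norm C \<le> w"
proof -
  have bound: "cmod (Complex (qform B x) (qform C x)) \<le> w * (norm x)\<^sup>2" for x
    using cmod_cinner_le_numerical_radius [of "B + \<i> *\<^sub>C C" x]
    unfolding cinner_cartesian [OF BC] w_def .
  have "0 \<le> w * (norm u)\<^sup>2"
    using bound [of u] norm_ge_zero order_trans by blast
  then show "0 \<le> w"
    using \<open>u \<noteq> 0\<close> by (simp add: zero_le_mult_iff)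
  then show "norm B \<le> w" "norm C \<le> w"
    using BC bound abs_Re_le_cmod [of "Complex _ _"] abs_Im_le_cmod [of "Complex _ _"]
    by (auto intro!: norm_selfadjoint_le intro: order_trans [OF _ bound])
qed

lemma cadjoint_cartesian:
  assumes "selfadjoint B" "selfadjoint C"
  shows "cadjoint (B + \<i> *\<^sub>C C) = B - \<i> *\<^sub>C C"
  using assms unfolding selfadjoint_iff
  by (intro cadjoint_eqI)
    (simp add: cinner_add_left cinner_diff_right cinner_scaleC_left cinner_scaleC_right)

lemma cartesian_square_sum:
  fixes B C :: "'a::complex_hilbert bop"
  shows "(B - \<i> *\<^sub>C C) * (B + \<i> *\<^sub>C C) + (B + \<i> *\<^sub>C C) * (B - \<i> *\<^sub>C C) = 2 *\<^sub>R (B\<^sup>2 + C\<^sup>2)"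
proof (rule bop_eqI)
  have neg: "(- 1) *\<^sub>C x = - (x :: 'a)" for x
    using scaleC_of_real [of "- 1" x] by simp
  show "bop_apply ((B - \<i> *\<^sub>C C) * (B + \<i> *\<^sub>C C) + (B + \<i> *\<^sub>C C) * (B - \<i> *\<^sub>C C)) x
      = bop_apply (2 *\<^sub>R (B\<^sup>2 + C\<^sup>2)) x" for x
    by (simp add: bop_apply_linear bop_apply_diff scaleC_add_right scaleC_diff_right scaleC_scaleC
        neg power2_eq_square scaleR_2)
qed

theorem corollary2p2:
  fixes A B C :: "'a::complex_hilbert bop"
  assumes "selfadjoint B" and "selfadjoint C" and "A = B + \<i> *\<^sub>C C"
  shows "(\<forall>r::real. 1 \<le> r \<and> r \<le> 2 \<longrightarrow>
       1 / 4 powr r * norm (cadjoint A * A + A * cadjoint A) powr r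
         \<le> norm (integral {0..1} (\<lambda>t. bop_powr ((1 - t) *\<^sub>R B\<^sup>2 + t *\<^sub>R C\<^sup>2) r)) \<and>
       norm (integral {0..1} (\<lambda>t. bop_powr ((1 - t) *\<^sub>R B\<^sup>2 + t *\<^sub>R C\<^sup>2) r))
         \<le> numerical_radius A powr (2 * r)) \<and>
     1 / 4 * norm (cadjoint A * A + A * cadjoint A)
       \<le> norm (integral {0..1} (\<lambda>t. ((1 - t) *\<^sub>R B\<^sup>2 + t *\<^sub>R C\<^sup>2)\<^sup>2)) powr (1 / 2) \<and>
     norm (integral {0..1} (\<lambda>t. ((1 - t) *\<^sub>R B\<^sup>2 + t *\<^sub>R C\<^sup>2)\<^sup>2)) powr (1 / 2)
       \<le> (numerical_radius A)\<^sup>2"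
proof -
  define M where "M = (1/2) *\<^sub>R (B\<^sup>2 + C\<^sup>2)"
  define J where "J r = norm (integral {0..1} (\<lambda>t. bop_powr ((1 - t) *\<^sub>R B\<^sup>2 + t *\<^sub>R C\<^sup>2) r))" for r
  define w where "w = numerical_radius A"
  have pos: "bop_positive (B\<^sup>2)" "bop_positive (C\<^sup>2)"
    using assms(1,2) by (simp_all add: bop_positive_square)
  have "cadjoint A * A + A * cadjoint A = 4 *\<^sub>R M"
    unfolding assms(3) cadjoint_cartesian [OF assms(1,2)] cartesian_square_sum by (simp add: M_def)
  then have norm_A: "norm (cadjoint A * A + A * cadjoint A) = 4 * norm M"
    by simp
  have lower: "norm M powr r \<le> J r" if "1 \<le> r" for r
    unfolding M_def J_def by (rule norm_average_powr_le [OF pos that])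
  have upper: "J r \<le> (w\<^sup>2) powr r \<and> J r \<le> w powr (2 * r)" if "1 \<le> r" for r
  proof (cases "\<exists>u::'a. u \<noteq> 0")
    case True
    then obtain u :: 'a where "u \<noteq> 0"
      by blast
    note w = norm_cartesian_le_numerical_radius [OF assms(1,2) this, folded assms(3) w_def]
    have square: "norm (T\<^sup>2) \<le> w\<^sup>2" if "norm T \<le> w" for T :: "'a bop"
      using norm_mult_ineq [of T T] mult_mono [OF that that w(1)] unfolding power2_eq_square by simp
    have "J r \<le> (w\<^sup>2) powr r"
      unfolding J_def using \<open>1 \<le> r\<close> w by (intro norm_integral_bop_powr_le pos square) simp_all
    moreover have "(w\<^sup>2) powr r = w powr (2 * r)"
      using w(1) by (simp add: powr_powr flip: powr_numeral)
    ultimately show ?thesis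
      by simp
  next
    (* On the zero space the numerical radius is an unspecified number, but every operator vanishes. *)
    case False
    then have "T = 0" for T :: "'a bop"
      by (intro bop_eqI) simp
    then have "J r = 0"
      unfolding J_def by (metis norm_zero)
    then show ?thesis
      by simp
  qed
  have "integral {0..1} (\<lambda>t. bop_powr ((1 - t) *\<^sub>R B\<^sup>2 + t *\<^sub>R C\<^sup>2) 2)
      = integral {0..1} (\<lambda>t. ((1 - t) *\<^sub>R B\<^sup>2 + t *\<^sub>R C\<^sup>2)\<^sup>2)"
    by (intro integral_cong bop_powr_two bop_positive_combination pos) auto
  then have J_two: "norm (integral {0..1} (\<lambda>t. ((1 - t) *\<^sub>R B\<^sup>2 + t *\<^sub>R C\<^sup>2)\<^sup>2)) = J 2"
    by (simp add: J_def)
  have root: "(x powr 2) powr (1 / 2) = x" if "0 \<le> x" for x :: real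
    using that by (simp add: powr_powr)
  have "(norm M powr 2) powr (1 / 2) \<le> J 2 powr (1 / 2)"
    using lower [of 2] by (intro powr_mono2) simp_all
  moreover have "J 2 powr (1 / 2) \<le> w\<^sup>2"
  proof -
    have "J 2 powr (1 / 2) \<le> ((w\<^sup>2) powr 2) powr (1 / 2)"
      using upper [of 2] by (intro powr_mono2) (simp_all add: J_def)
    also have "\<dots> = w\<^sup>2"
      by (rule root) simp
    finally show ?thesis .
  qed
  moreover have "1 / 4 powr r * (4 * norm M) powr r \<le> J r" if "1 \<le> r" for r
    using lower [OF that] by (simp add: powr_mult)
  ultimately show ?thesis
    unfolding norm_A J_two w_def [symmetric] J_def [symmetric] using upper by (simp add: root)
qed

end
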